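(* Let $\mu$ be a strict partition of $m$ and let $\rho$ be an odd partition with no part equal to $1$. Then for every integer $n\ge0$, $$\mathbb{E}_{\mu,n}[\mathfrak{p}_\rho]=\mathfrak{p}_\rho(\mu).$$ In particular (case $\rho=\emptyset$), $\sum_{\lambda\in\mathcal{SP}_{n+m}}\frac{m!}{(n+m)!}2^{n-\ell(\lambda)+\ell(\mu)}\frac{g^\lambda}{g^\mu}g^{\lambda/\mu}=1$.
   Context: Partitions are finite weakly decreasing sequences of positive integers; $\ell$ = length, $|\cdot|$ = size; strict = distinct parts, odd = all parts odd; $\mathcal{SP}_k,\mathcal{OP}_k$ the strict/odd partitions of $k$. Shifted diagram $S(\lambda)=\{(i,j):1\le i\le\ell(\lambda),\ i\le j\le\lambda_i+i-1\}$. For strict $\lambda,\mu$ with $S(\lambda)\supseteq S(\mu)$, $g^{\lambda/\mu}$ is the number of chains $\mu=\lambda^{(0)},\dots,\lambda^{(k)}=\lambda$ ($k=|\lambda|-|\mu|$) of strict partitions, each diagram obtained from the previous by adding one box; $g^{\lambda/\mu}=0$ otherwise; $g^\lambda=g^{\lambda/\emptyset}$. For a function $\varphi$ on strict partitions, $\mathbb{E}_{\mu,n}[\varphi]=\sum_{\lambda\in\mathcal{SP}_{n+m}}\frac{m!}{(n+m)!}2^{n-\ell(\lambda)+\ell(\mu)}\frac{g^\lambda}{g^\mu}g^{\lambda/\mu}\varphi(\lambda)$. $p_r=\sum_ix_i^r$; $\Gamma$ = $\mathbb{Q}$-algebra generated by $p_1,p_3,\dots$; for $f\in\Gamma$, $f(\lambda)=f(\lambda_1,\dots,\lambda_{\ell(\lambda)},0,\dots)$.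 For $\rho\in\mathcal{OP}$: $p_\rho=\prod_ip_{\rho_i}$, $z_\rho=\prod_rr^{m_r(\rho)}m_r(\rho)!$; scalar product $\langle p_\rho,p_\sigma\rangle=2^{-\ell(\rho)}z_\rho\delta_{\rho\sigma}$. For strict $\lambda$ of length $l$, $P_\lambda(x_1,\dots,x_N)=\frac1{(N-l)!}\sum_{\omega\in S_N}\omega\big(x_1^{\lambda_1}\cdots x_l^{\lambda_l}\prod_{1\le i\le l,\,i<j\le N}\frac{x_i+x_j}{x_i-x_j}\big)$ ($N\ge l$; zero if $N<l$), $Q_\lambda=2^{\ell(\lambda)}P_\lambda$, and $P^*_\lambda$ is defined by the same formula with $x_i^{\lambda_i}$ replaced by $x_i^{\downarrow\lambda_i}=x_i(x_i-1)\cdots(x_i-\lambda_i+1)$. $X^\lambda_\rho=\langle p_\rho,Q_\lambda\rangle$ for $|\lambda|=|\rho|$, and $\mathfrak{p}_\rho=\sum_{\lambda\in\mathcal{SP}_{|\rho|}}X^\lambda_\rho P^*_\lambda\in\Gamma$; $\mathfrak p_\emptyset=1$. *)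

theory Defs
  imports Complex_Main "HOL-Combinatorics.Permutations"
begin

definition is_partition :: "nat list \<Rightarrow> bool" where
  "is_partition lam \<longleftrightarrow> sorted_wrt (\<ge>) lam \<and> 0 \<notin> set lam"

definition strict_partition :: "nat list \<Rightarrow> bool" where
  "strict_partition lam \<longleftrightarrow> is_partition lam \<and> distinct lam"

definition odd_partition :: "nat list \<Rightarrow> bool" where
  "odd_partition lam \<longleftrightarrow> is_partition lam \<and> (\<forall>r\<in>set lam. odd r)"

definition SP :: "nat \<Rightarrow> nat list set" where
  "SP k = {lam. strict_partition lam \<and> sum_list lam = k}"

definition shifted_diagram :: "nat list \<Rightarrow> (nat \<times> nat) set" where
  "shifted_diagram lam =
     {(i, j). 1 \<le> i \<and> i \<le> length lam \<and> i \<le> j \<and> j \<le> lam ! (i - 1) + i - 1}"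

definition adds_one_box :: "nat list \<Rightarrow> nat list \<Rightarrow> bool" where
  "adds_one_box nu nu' \<longleftrightarrow>
     (\<exists>b. b \<notin> shifted_diagram nu \<and> shifted_diagram nu' = insert b (shifted_diagram nu))"

definition shifted_chains :: "nat list \<Rightarrow> nat list \<Rightarrow> nat list list set" where
  "shifted_chains lam mu =
     {c. length c = Suc (sum_list lam - sum_list mu) \<and> hd c = mu \<and> last c = lam \<and>
         (\<forall>nu\<in>set c. strict_partition nu) \<and>
         (\<forall>i. Suc i < length c \<longrightarrow> adds_one_box (c ! i) (c ! Suc i))}"

definition g_skew :: "nat list \<Rightarrow> nat list \<Rightarrow> nat" where
  "g_skew lam mu =
     (if shifted_diagram mu \<subseteq> shifted_diagram lam then card (shifted_chains lam mu) else 0)"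

definition g_num :: "nat list \<Rightarrow> nat" where
  "g_num lam = g_skew lam []"

text \<open>The exponent \<open>n - \<ell>(\<lambda>) + \<ell>(\<mu>)\<close> can be negative (only where \<open>g\<^bsup>\<lambda>/\<mu>\<^esup> = 0\<close>), hence the integer power.\<close>

definition expect :: "nat list \<Rightarrow> nat \<Rightarrow> (nat list \<Rightarrow> rat) \<Rightarrow> rat" where
  "expect mu n \<phi> =
     (let m = sum_list mu in
      \<Sum>lam\<in>SP (n + m).
        fact m / fact (n + m) * 2 powi (int n - int (length lam) + int (length mu))
        * (of_nat (g_num lam) / of_nat (g_num mu)) * of_nat (g_skew lam mu) * \<phi> lam)"

text \<open>A symmetric function \<open>f\<close> is represented by the map sending a list \<open>[x\<^sub>1, \<dots>, x\<^sub>N]\<close> of rationals,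
  \<open>N\<close> arbitrary, to \<open>f(x\<^sub>1, \<dots>, x\<^sub>N, 0, 0, \<dots>)\<close>. As the rationals are infinite, \<open>f\<close> is determined by
  this map, and the power sums are algebraically independent as such maps, so \<open>\<Gamma>\<close> below is a
  faithful copy of the algebra of formal symmetric functions.\<close>

type_synonym symfun = "rat list \<Rightarrow> rat"

definition power_sum :: "nat \<Rightarrow> symfun" where
  "power_sum r xs = (\<Sum>x\<leftarrow>xs. x ^ r)"

inductive_set \<Gamma> :: "symfun set" where
  const: "(\<lambda>_. c) \<in> \<Gamma>"
| power_sum: "odd r \<Longrightarrow> power_sum r \<in> \<Gamma>"
| add: "f \<in> \<Gamma> \<Longrightarrow> h \<in> \<Gamma> \<Longrightarrow> (\<lambda>xs. f xs + h xs) \<in> \<Gamma>"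
| mult: "f \<in> \<Gamma> \<Longrightarrow> h \<in> \<Gamma> \<Longrightarrow> (\<lambda>xs. f xs * h xs) \<in> \<Gamma>"

definition at_partition :: "symfun \<Rightarrow> nat list \<Rightarrow> rat" where
  "at_partition f lam = f (map of_nat lam)"

definition power_sum_part :: "nat list \<Rightarrow> symfun" where
  "power_sum_part \<rho> xs = (\<Prod>r\<leftarrow>\<rho>. power_sum r xs)"

definition z_factor :: "nat list \<Rightarrow> rat" where
  "z_factor \<rho> = (\<Prod>r\<in>set \<rho>. of_nat r ^ count_list \<rho> r * fact (count_list \<rho> r))"

text \<open>Coordinates of an element of \<open>\<Gamma>\<close> in the basis \<open>p\<^sub>\<rho>\<close>, \<open>\<rho>\<close> an odd partition; the scalar product is
  the bilinear extension of its values on this basis.\<close>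

definition p_coeff :: "symfun \<Rightarrow> nat list \<Rightarrow> rat" where
  "p_coeff f = (THE c. finite {\<rho>. c \<rho> \<noteq> 0} \<and> (\<forall>\<rho>. c \<rho> \<noteq> 0 \<longrightarrow> odd_partition \<rho>) \<and>
                       (\<forall>xs. f xs = (\<Sum>\<rho> | c \<rho> \<noteq> 0. c \<rho> * power_sum_part \<rho> xs)))"

definition scalar_product :: "symfun \<Rightarrow> symfun \<Rightarrow> rat" where
  "scalar_product f h =
     (\<Sum>\<rho> | p_coeff f \<rho> \<noteq> 0. p_coeff f \<rho> * p_coeff h \<rho> * (z_factor \<rho> / 2 ^ length \<rho>))"

text \<open>The symmetrised sum defining \<open>P\<^sub>\<lambda>\<close> and \<open>P\<^sup>*\<^sub>\<lambda>\<close> in \<open>N = length xs\<close> variables, where \<open>pw x k\<close> stands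
  for \<open>x\<^sup>k\<close> or for the falling factorial. Indices start at 0. The formula is only meaningful when
  the entries of \<open>xs\<close> are pairwise distinct.\<close>

definition symmetrised_sum :: "(rat \<Rightarrow> nat \<Rightarrow> rat) \<Rightarrow> nat list \<Rightarrow> rat list \<Rightarrow> rat" where
  "symmetrised_sum pw lam xs =
     (let N = length xs; l = length lam in
      if N < l then 0
      else 1 / fact (N - l) *
        (\<Sum>\<omega> | \<omega> permutes {..<N}.
           (\<Prod>i<l. pw (xs ! \<omega> i) (lam ! i)) *
           (\<Prod>i<l. \<Prod>j\<in>{i<..<N}. (xs ! \<omega> i + xs ! \<omega> j) / (xs ! \<omega> i - xs ! \<omega> j))))"

text \<open>The element of \<open>\<Gamma>\<close> given by this formula. Requiring agreement at lists of distinct rationals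
  pins it down, since in each number of variables it is a polynomial.\<close>

definition symmetrised :: "(rat \<Rightarrow> nat \<Rightarrow> rat) \<Rightarrow> nat list \<Rightarrow> symfun" where
  "symmetrised pw lam =
     (THE f. f \<in> \<Gamma> \<and> (\<forall>xs. distinct xs \<longrightarrow> f xs = symmetrised_sum pw lam xs))"

definition falling :: "rat \<Rightarrow> nat \<Rightarrow> rat" where
  "falling x k = (\<Prod>i<k. x - of_nat i)"

definition schur_P :: "nat list \<Rightarrow> symfun" where
  "schur_P = symmetrised (\<lambda>x k. x ^ k)"

definition schur_Q :: "nat list \<Rightarrow> symfun" where
  "schur_Q lam xs = 2 ^ length lam * schur_P lam xs"

definition factorial_P :: "nat list \<Rightarrow> symfun" where
  "factorial_P = symmetrised falling"

definition X_char :: "nat list \<Rightarrow> nat list \<Rightarrow> rat" where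
  "X_char lam \<rho> = scalar_product (power_sum_part \<rho>) (schur_Q lam)"

definition frak_p :: "nat list \<Rightarrow> symfun" where
  "frak_p \<rho> xs = (\<Sum>lam\<in>SP (sum_list \<rho>). X_char lam \<rho> * factorial_P lam xs)"

end

theory Submission
  imports Defs "HOL-Combinatorics.Multiset_Permutations"
    "HOL-Computational_Algebra.Formal_Power_Series"
    "HOL-Computational_Algebra.Polynomial"
begin

text \<open>
  Put \<open>d\<^sub>\<lambda> = g\<^sup>\<lambda> / |\<lambda>|!\<close> and let \<open>w(\<mu>, \<lambda>) = 2\<close> raised to \<open>1 - \<ell>(\<lambda>) + \<ell>(\<mu>)\<close>. Splitting off the first
  box of a chain shows that the theorem holds for every \<open>\<phi>\<close> which is harmonic, that is,
  \<open>\<Sum> w(\<mu>, \<lambda>) d\<^sub>\<lambda> \<phi>(\<lambda>) = d\<^sub>\<mu> \<phi>(\<mu>)\<close>, summed over the strict \<open>\<lambda>\<close> covering \<open>\<mu>\<close>. By the vanishing property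
  and the Pieri rule \<open>(p\<^sub>1 - |\<nu>|) P\<^sup>*\<^sub>\<nu> = \<Sum> P\<^sup>*\<^sub>\<kappa>\<close> (over the covers \<open>\<kappa>\<close> of \<open>\<nu>\<close>), the product
  \<open>d\<^sub>\<lambda> P\<^sup>*\<^sub>\<nu>(\<lambda>)\<close> is the number of chains from \<open>\<nu>\<close> to \<open>\<lambda>\<close> divided by \<open>(|\<lambda>| - |\<nu>|)!\<close>, and the commutation
  relation \<open>D U = U D + 1\<close> of the weighted lattice of strict partitions gives
  \<open>\<Sum> w(\<mu>, \<lambda>) d\<^sub>\<lambda> P\<^sup>*\<^sub>\<nu>(\<lambda>) = d\<^sub>\<mu> (P\<^sup>*\<^sub>\<nu>(\<mu>) + \<Sum> w(\<kappa>, \<nu>) P\<^sup>*\<^sub>\<kappa>(\<mu>))\<close>, the last sum over the \<open>\<kappa>\<close> covered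
  by \<open>\<nu>\<close>. In the combination with the coefficients \<open>X\<^sup>\<nu>\<^sub>\<rho>\<close> the correction terms cancel: by the Pieri rule
  for \<open>P\<^sub>\<kappa>\<close> they are multiples of the \<open>p\<^sub>\<rho>\<close>-coordinate of \<open>p\<^sub>1 P\<^sub>\<kappa>\<close>, which is \<open>0\<close> if \<open>\<rho>\<close> has no part \<open>1\<close>.

  That \<open>P\<close> and \<open>P\<^sup>*\<close> lie in \<open>\<Gamma>\<close> is seen by peeling off one variable at a time: this reduces the
  symmetrised sum to the sums of \<open>x\<^sup>k \<Prod> (x + y) / (x - y)\<close> over the variables \<open>x\<close>, which are half the
  coefficients of \<open>\<Prod> (1 + x t) / (1 - x t)\<close>.
\<close>

section \<open>One-row functions\<close>

definition cross :: "rat \<Rightarrow> rat set \<Rightarrow> rat" where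
  "cross x Y = (\<Prod>y\<in>Y. (x + y) / (x - y))"

text \<open>The symmetrised sum organised by the variable \<open>x\<close> that receives the first
  part: its factors against all remaining variables form \<open>cross x (X - {x})\<close>, and what
  is left has the same shape. Variables that receive no part are never ordered, which accounts for
  the factor 1/(N-l)!.\<close>

fun sym_sum :: "(rat \<Rightarrow> nat \<Rightarrow> rat) \<Rightarrow> nat list \<Rightarrow> rat set \<Rightarrow> rat" where
  "sym_sum pw [] X = 1"
| "sym_sum pw (a # as) X = (\<Sum>x\<in>X. pw x a * cross x (X - {x}) * sym_sum pw as (X - {x}))"

lemma cross_empty [simp]: "cross x {} = 1"
  by (simp add: cross_def)

lemma cross_insert:
  assumes "finite Y" "z \<notin> Y"
  shows "cross x (insert z Y) = (x + z) / (x - z) * cross x Y"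
  using assms by (simp add: cross_def)

lemma cross_insert_Diff:
  assumes "finite X" "z \<notin> X" "x \<in> X"
  shows "cross x (insert z X - {x}) = (x + z) / (x - z) * cross x (X - {x})"
proof -
  have "insert z X - {x} = insert z (X - {x})"
    using assms by auto
  then show ?thesis
    using assms by (simp add: cross_insert)
qed

text \<open>As a function of \<open>y\<close>, \<open>cross y X\<close> is rational with simple
  poles at elements of \<open>X\<close>; it tends to 1 at infinity and has residue
  \<open>2 * x * cross x (X - {x})\<close> at \<open>x\<close>.\<close>

lemma cross_partial_fractions:
  assumes "finite X" "y \<notin> X"
  shows "cross y X = 1 + (\<Sum>x\<in>X. 2 * x / (y - x) * cross x (X - {x}))"
  using assms
proof (induction X arbitrary: y rule: finite_induct)
  case (insert z X)
  have y: "y \<noteq> z" "y \<notin> X"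
    using insert.prems by auto
  \<comment> \<open>Partial fractions in \<open>y\<close> for a product of two simple poles, at
    \<open>x\<close> and at the new element \<open>z\<close>.\<close>
  have split: "(y + z) / (y - z) * (2 * x / (y - x) * c) =
      2 * x / (y - x) * ((x + z) / (x - z) * c) + 2 * z / (y - z) * (2 * x / (z - x) * c)"
    if "x \<in> X" for x c
  proof -
    have "x \<noteq> z" "y \<noteq> x"
      using insert.hyps insert.prems that by auto
    then have "x - z \<noteq> 0" "z - x \<noteq> 0" "y - x \<noteq> 0" "y - z \<noteq> 0"
      using y by auto
    then show ?thesis
      by (simp add: divide_simps) (simp add: algebra_simps)
  qed
  let ?S = "\<lambda>y. \<Sum>x\<in>X. 2 * x / (y - x) * cross x (X - {x})"
  let ?T = "\<Sum>x\<in>X. 2 * x / (y - x) * ((x + z) / (x - z) * cross x (X - {x}))"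
  have "(y + z) / (y - z) * ?S y = ?T + 2 * z / (y - z) * ?S z"
    by (simp only: sum_distrib_left sum.distrib [symmetric]) (rule sum.cong[OF refl], rule split)
  moreover have "(y + z) / (y - z) = 1 + 2 * z / (y - z)"
    using y by (simp add: field_simps)
  moreover have "cross y (insert z X) = (y + z) / (y - z) * (1 + ?S y)"
    using insert y by (simp add: cross_insert)
  moreover have "cross z X = 1 + ?S z"
    using insert.IH[of z] insert.hyps by simp
  ultimately have "cross y (insert z X) = 1 + ?T + 2 * z / (y - z) * cross z X"
    by (simp only: distrib_left distrib_right mult_1_left mult_1_right add.assoc add.commute add.left_commute)
  moreover have "?T = (\<Sum>x\<in>X. 2 * x / (y - x) * cross x (insert z X - {x}))"
    by (intro sum.cong refl) (simp add: cross_insert_Diff insert.hyps)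
  ultimately show ?case
    using insert.hyps by simp
qed simp

text \<open>For k > 0 this is the one-row P-function, half the coefficient of t^k in \<Prod> (1 + x
  t) / (1 - x t). Order 0 is exceptional: on finite sets it depends only on the parity of the number
  of variables.\<close>

definition cross_moment :: "nat \<Rightarrow> rat set \<Rightarrow> rat" where
  "cross_moment k X = (\<Sum>x\<in>X. x ^ k * cross x (X - {x}))"

text \<open>The factor x - z clears the denominator contributed by \<open>z\<close> and leaves x +
  z; the term x = z drops out. Coefficients of a power series change by the same rule under
  multiplication with (1 + z t) / (1 - z t).\<close>

lemma cross_moment_insert:
  assumes "finite X" "z \<notin> X"
  shows "cross_moment (Suc k) (insert z X) - z * cross_moment k (insert z X) =
    cross_moment (Suc k) X + z * cross_moment k X"
proof -
  have *: "x ^ k * cross x (insert z X - {x}) * (x - z) = x ^ k * cross x (X - {x}) * (x + z)"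
    if "x \<in> X" for x
  proof -
    have "x \<noteq> z" using that assms by auto
    then show ?thesis using that assms by (simp add: cross_insert_Diff)
  qed
  have "cross_moment (Suc k) (insert z X) - z * cross_moment k (insert z X) =
      (\<Sum>x\<in>X. x ^ k * cross x (insert z X - {x}) * (x - z))"
    using assms unfolding cross_moment_def
    by (simp add: algebra_simps sum_distrib_left sum_subtractf)
  also have "\<dots> = (\<Sum>x\<in>X. x ^ k * cross x (X - {x}) * (x + z))"
    by (intro sum.cong refl *)
  also have "\<dots> = cross_moment (Suc k) X + z * cross_moment k X"
    unfolding cross_moment_def by (simp add: algebra_simps sum_distrib_left sum.distrib)
  finally show ?thesis .
qed

text \<open>For x in \<open>X\<close> the factors 1 and (x + z) / (x - z) add up to -2x / (z - x),
  so the sum is the partial fraction expansion of \<open>cross z X\<close>.\<close>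

lemma cross_moment_0_insert:
  assumes "finite X" "z \<notin> X"
  shows "cross_moment 0 (insert z X) + cross_moment 0 X = 1"
proof -
  have *: "cross x (insert z X - {x}) + cross x (X - {x}) = - (2 * x / (z - x) * cross x (X - {x}))"
    if "x \<in> X" for x
  proof -
    have "x \<noteq> z" using that assms by auto
    then show ?thesis using that assms by (simp add: cross_insert_Diff field_simps)
  qed
  have "cross_moment 0 (insert z X) + cross_moment 0 X =
      cross z X + (\<Sum>x\<in>X. cross x (insert z X - {x}) + cross x (X - {x}))"
    using assms by (simp add: cross_moment_def sum.distrib)
  also have "\<dots> = cross z X - (\<Sum>x\<in>X. 2 * x / (z - x) * cross x (X - {x}))"
    by (simp add: * sum_negf)
  also have "\<dots> = 1"
    by (simp add: cross_partial_fractions[OF assms])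
  finally show ?thesis .
qed

lemma cross_moment_1:
  assumes "finite X"
  shows "cross_moment 1 X = \<Sum>X"
  using assms
proof (induction X rule: finite_induct)
  case (insert z X)
  have "cross_moment 1 (insert z X) =
      cross_moment 1 X + z * (cross_moment 0 (insert z X) + cross_moment 0 X)"
    using cross_moment_insert[OF insert.hyps, of 0] by (simp add: algebra_simps)
  then show ?case
    using insert by (simp add: cross_moment_0_insert)
qed (simp add: cross_moment_def)

text \<open>The series \<open>\<Prod> (1 + x t) / (1 - x t)\<close>, whose coefficients are the one-row functions \<open>q\<^sub>k\<close>.\<close>

fun q_series :: "rat list \<Rightarrow> rat fps" where
  "q_series [] = 1"
| "q_series (x # xs) = (1 + fps_const x * fps_X) * inverse (1 - fps_const x * fps_X) * q_series xs"

lemma q_series_Cons: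
  "(1 - fps_const x * fps_X) * q_series (x # xs) = (1 + fps_const x * fps_X) * q_series xs"
proof -
  have "(1 - fps_const x * fps_X) * inverse (1 - fps_const x * fps_X) = 1"
    by (subst mult.commute, rule inverse_mult_eq_1) simp
  then show ?thesis
    by (metis (no_types, opaque_lifting) mult.assoc mult.commute mult_1_left q_series.simps(2))
qed

lemma q_series_nth_0 [simp]: "fps_nth (q_series xs) 0 = 1"
  by (induction xs) simp_all

lemma q_series_Cons_nth:
  "fps_nth (q_series (x # xs)) (Suc k) - x * fps_nth (q_series (x # xs)) k =
   fps_nth (q_series xs) (Suc k) + x * fps_nth (q_series xs) k"
  using arg_cong[OF q_series_Cons[of x xs], of "\<lambda>f. fps_nth f (Suc k)"]
  by (simp add: algebra_simps del: q_series.simps)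

text \<open>Both sides obey the same recursion when a variable is added, which determines order k +
  1 from order k. The induction starts at order 1, where both are twice the sum of the variables; at
  order 0 the two sides would not agree.\<close>

lemma q_series_nth:
  assumes "distinct xs"
  shows "fps_nth (q_series xs) (Suc k) = 2 * cross_moment (Suc k) (set xs)"
  using assms
proof (induction xs arbitrary: k)
  case Nil
  then show ?case by (simp add: cross_moment_def)
next
  case (Cons z xs)
  then have z: "finite (set xs)" "z \<notin> set xs" and IH: "\<And>k. fps_nth (q_series xs) (Suc k) = 2 * cross_moment (Suc k) (set xs)"
    by auto
  show ?case
  proof (induction k)
    case 0
    show ?case
      using q_series_Cons_nth[of z xs 0] IH[of 0] z
        cross_moment_1[of "set xs"] cross_moment_1[of "insert z (set xs)"] 
      by (simp del: q_series.simps)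
  next
    case (Suc k)
    show ?case
      using q_series_Cons_nth[of z xs "Suc k"] Suc IH cross_moment_insert[OF z, of "Suc k"]
      by (simp add: algebra_simps del: q_series.simps)
  qed
qed

text \<open>The logarithmic derivative of \<open>q_series\<close>: each variable contributes x / (1
  + x t) + x / (1 - x t) = 2x / (1 - x^2 t^2), so only odd power sums occur.\<close>

definition odd_power_series :: "rat list \<Rightarrow> rat fps" where
  "odd_power_series xs = Abs_fps (\<lambda>i. if even i then 2 * power_sum (Suc i) xs else 0)"

lemma fps_deriv_q_series: "fps_deriv (q_series xs) = q_series xs * odd_power_series xs"
proof (induction xs)
  case Nil
  have "odd_power_series [] = 0"
    by (rule fps_ext) (simp add: odd_power_series_def power_sum_def)
  then show ?case by simp
next
  case (Cons x xs)
  let ?m = "1 - fps_const x * fps_X" and ?p = "1 + fps_const x * fps_X"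
  have add: "odd_power_series (x # xs) = odd_power_series [x] + odd_power_series xs"
    by (rule fps_ext) (simp add: odd_power_series_def power_sum_def)
  have single: "?m * ?p * odd_power_series [x] = fps_const (2 * x)"
  proof -
    have "odd_power_series [x] - fps_const (x * x) * (fps_X ^ 2 * odd_power_series [x]) = fps_const (2 * x)"
    proof (rule fps_ext)
      fix n
      consider "n = 0" | "n = 1" | m where "n = Suc (Suc m)"
        by (metis One_nat_def not0_implies_Suc)
      then show "fps_nth (odd_power_series [x] - fps_const (x * x) * (fps_X ^ 2 * odd_power_series [x])) n = fps_nth (fps_const (2 * x)) n"
        by cases (simp_all add: odd_power_series_def power_sum_def fps_X_power_mult_nth)
    qed
    moreover have prod: "?m * ?p = 1 - fps_const (x * x) * fps_X ^ 2"
      by (simp add: algebra_simps power2_eq_square)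
    ultimately show ?thesis
      unfolding prod by (simp add: left_diff_distrib mult.assoc)
  qed
  have "fps_deriv (?m * q_series (x # xs)) = fps_deriv (?p * q_series xs)"
    by (simp only: q_series_Cons)
  then have deriv: "?m * fps_deriv (q_series (x # xs)) =
      fps_const x * q_series (x # xs) + fps_const x * q_series xs + ?p * q_series xs * odd_power_series xs"
    using Cons by (simp add: algebra_simps del: q_series.simps)
  \<comment> \<open>The identity is proved after multiplication by (1 - x t)(1 + x t), which is
    cancelled at the end because its constant term is 1.\<close>
  have ring: "p * m * dq' = p * m * (q' * (L1 + L))"
    if "m * dq' = c * q' + c * q + p * q * L" "m * q' = p * q" "m * p * L1 = 2 * c" "m + p = 2"
    for m p q q' dq' L L1 c :: "rat fps"
  proof -
    have "p * m * dq' = c * (p * q') + c * (p * q) + p * (p * q) * L"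
      using arg_cong[OF that(1), of "\<lambda>u. p * u"] by (simp add: algebra_simps)
    also have "\<dots> = c * (p * q') + c * (m * q') + p * (m * q') * L"
      by (simp only: that(2))
    also have "\<dots> = c * (m + p) * q' + p * m * q' * L"
      by (simp add: algebra_simps)
    also have "c * (m + p) = m * p * L1"
      by (simp add: that(3,4))
    finally show ?thesis
      by (simp add: algebra_simps)
  qed
  have "?m * ?p * odd_power_series [x] = 2 * fps_const x" "?m + ?p = 2"
    using single by (simp_all add: fps_numeral_fps_const)
  then have "?p * ?m * fps_deriv (q_series (x # xs)) =
      ?p * ?m * (q_series (x # xs) * odd_power_series (x # xs))"
    unfolding add by (rule ring[OF deriv q_series_Cons])
  moreover have "?p * ?m \<noteq> 0"
  proof -
    have "fps_nth (?p * ?m) 0 \<noteq> fps_nth 0 0"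
      by (simp add: fps_mult_nth)
    then show ?thesis
      by metis
  qed
  ultimately show ?case
    using mult_left_cancel by blast
qed

text \<open>Comparison of coefficients in the differential equation. Each coefficient becomes a
  polynomial in earlier ones and odd power sums, which is what places it in
  \<open>\<Gamma>\<close>.\<close>

lemma q_series_recursion:
  "fps_nth (q_series xs) (Suc n) =
   (\<Sum>i\<le>n. (1 / of_nat (Suc n)) * (fps_nth (q_series xs) (n - i) *
      (if even i then 2 * power_sum (Suc i) xs else 0)))"
proof -
  have "of_nat (Suc n) * fps_nth (q_series xs) (Suc n) = fps_nth (odd_power_series xs * q_series xs) n"
    using arg_cong[OF fps_deriv_q_series[of xs], of "\<lambda>f. fps_nth f n"]
    by (simp add: mult.commute[of "q_series xs"])
  also have "\<dots> = (\<Sum>i\<le>n. fps_nth (q_series xs) (n - i) * (if even i then 2 * power_sum (Suc i) xs else 0))"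
    by (subst fps_mult_nth) (simp add: odd_power_series_def mult.commute atMost_atLeast0)
  finally show ?thesis
    by (simp add: sum_divide_distrib[symmetric] eq_divide_eq mult.commute del: of_nat_Suc)
qed

lemma \<Gamma>_sum:
  assumes "finite I" "\<And>i. i \<in> I \<Longrightarrow> f i \<in> \<Gamma>"
  shows "(\<lambda>xs. \<Sum>i\<in>I. f i xs) \<in> \<Gamma>"
  using assms by (induction I rule: finite_induct) (auto intro: \<Gamma>.intros)

lemma q_series_in_\<Gamma>: "(\<lambda>xs. fps_nth (q_series xs) k) \<in> \<Gamma>"
proof (induction k rule: less_induct)
  case (less k)
  show ?case
  proof (cases k)
    case 0
    then show ?thesis by (simp add: \<Gamma>.const)
  next
    case (Suc n)
    have "(\<lambda>xs. if even i then 2 * power_sum (Suc i) xs else 0) \<in> \<Gamma>" for i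
      using \<Gamma>.mult[OF \<Gamma>.const[of 2] \<Gamma>.power_sum[of "Suc i"]]
      by (cases "even i") (simp_all add: \<Gamma>.const)
    then have "(\<lambda>xs. (1 / of_nat (Suc n)) * (fps_nth (q_series xs) (n - i) *
        (if even i then 2 * power_sum (Suc i) xs else 0))) \<in> \<Gamma>" for i
      using less[of "n - i"] Suc by (intro \<Gamma>.mult \<Gamma>.const) auto
    then show ?thesis
      unfolding Suc q_series_recursion by (intro \<Gamma>_sum) simp_all
  qed
qed

section \<open>Membership of symmetrised sums in the ring\<close>

definition seq_weight :: "(rat \<Rightarrow> nat \<Rightarrow> rat) \<Rightarrow> nat list \<Rightarrow> rat list \<Rightarrow> rat" where
  "seq_weight pw lam ys = (\<Prod>i<length lam. pw (ys ! i) (lam ! i)) *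
     (\<Prod>i<length lam. \<Prod>j\<in>{i<..<length ys}. (ys ! i + ys ! j) / (ys ! i - ys ! j))"

lemma seq_weight_Cons:
  assumes "distinct ys"
  shows "seq_weight pw (a # as) (y # ys) = pw y a * cross y (set ys) * seq_weight pw as ys"
proof -
  have shift: "(\<Prod>j\<in>{Suc i<..<Suc n}. f j) = (\<Prod>j\<in>{i<..<n}. f (Suc j))" for i n and f :: "nat \<Rightarrow> rat"
    by (rule prod.reindex_bij_witness[of _ Suc "\<lambda>j. j - 1"]) auto
  have "{0<..<Suc n} = Suc ` {..<n}" for n
    by (auto simp: image_iff Bex_def) (metis Suc_pred less_Suc_eq_le Suc_le_eq)
  then have "(\<Prod>j\<in>{0<..<Suc (length ys)}. (y + (y # ys) ! j) / (y - (y # ys) ! j)) =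
      (\<Prod>j<length ys. (y + ys ! j) / (y - ys ! j))"
    by (simp add: prod.reindex)
  also have "\<dots> = cross y (set ys)"
    unfolding cross_def using assms
    by (intro prod.reindex_bij_betw bij_betw_nth) auto
  finally show ?thesis
    by (simp add: seq_weight_def prod.lessThan_Suc_shift shift del: prod.lessThan_Suc)
qed

lemma sym_sum_eq_0:
  assumes "finite X" "card X < length as"
  shows "sym_sum pw as X = 0"
  using assms
proof (induction as arbitrary: X)
  case (Cons a as)
  have "sym_sum pw as (X - {x}) = 0" if "x \<in> X" for x
    using Cons.prems that card_gt_0_iff[of X] by (intro Cons.IH) (auto simp: card_Diff_singleton)
  then show ?case by simp
qed simp

text \<open>Grouping the orderings by their first entry peels off one part at a time; when the parts
  are exhausted, the orderings of the remaining variables all have weight 1 and give the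
  factorial.\<close>

lemma sum_seq_weight:
  assumes "finite X" "length as \<le> card X"
  shows "(\<Sum>ys\<in>permutations_of_set X. seq_weight pw as ys) =
    fact (card X - length as) * sym_sum pw as X"
  using assms
proof (induction as arbitrary: X)
  case Nil
  then show ?case
    by (simp add: seq_weight_def)
next
  case (Cons a as)
  have "X \<noteq> {}"
    using Cons.prems by auto
  have "(\<Sum>ys\<in>permutations_of_set X. seq_weight pw (a # as) ys) =
      (\<Sum>x\<in>X. \<Sum>ys\<in>(#) x ` permutations_of_set (X - {x}). seq_weight pw (a # as) ys)"
    unfolding permutations_of_set_nonempty[OF \<open>X \<noteq> {}\<close>] using Cons.prems
    by (intro sum.UNION_disjoint) auto
  also have "\<dots> = (\<Sum>x\<in>X. \<Sum>ys\<in>permutations_of_set (X - {x}). pw x a * cross x (X - {x}) * seq_weight pw as ys)"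
    by (simp add: sum.reindex inj_on_def seq_weight_Cons permutations_of_setD)
  also have "\<dots> = (\<Sum>x\<in>X. pw x a * cross x (X - {x}) *
      (fact (card X - length (a # as)) * sym_sum pw as (X - {x})))"
    using Cons.prems by (intro sum.cong refl)
      (simp add: sum_distrib_left[symmetric] Cons.IH card_Diff_singleton)
  finally show ?case
    by (simp add: sum_distrib_left mult_ac)
qed

lemma sum_permutes_distinct:
  assumes "distinct xs"
  shows "(\<Sum>\<omega> | \<omega> permutes {..<length xs}. f (permute_list \<omega> xs)) =
    (\<Sum>ys\<in>permutations_of_set (set xs). f ys)"
proof -
  let ?P = "{\<omega>. \<omega> permutes {..<length xs}}"
  have inj: "inj_on (\<lambda>\<omega>. permute_list \<omega> xs) ?P"
  proof (intro inj_onI ext)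
    fix \<omega> \<tau> i
    assume *: "\<omega> \<in> ?P" "\<tau> \<in> ?P" "permute_list \<omega> xs = permute_list \<tau> xs"
    show "\<omega> i = \<tau> i"
    proof (cases "i < length xs")
      case True
      then have "xs ! \<omega> i = xs ! \<tau> i" "\<omega> i < length xs" "\<tau> i < length xs"
        using * by (metis mem_Collect_eq permute_list_nth, auto dest: permutes_in_image)
      then show ?thesis
        using assms nth_eq_iff_index_eq by blast
    next
      case False
      then show ?thesis
        using * by (auto simp: permutes_def)
    qed
  qed
  have "(\<lambda>\<omega>. permute_list \<omega> xs) ` ?P = permutations_of_set (set xs)"
  proof (rule card_subset_eq)
    show "card ((\<lambda>\<omega>. permute_list \<omega> xs) ` ?P) = card (permutations_of_set (set xs))"
      using assms by (simp add: card_image[OF inj] card_permutations distinct_card)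
  qed (use assms in auto)
  then show ?thesis
    using sum.reindex[OF inj, of f] by (simp add: o_def)
qed

lemma symmetrised_sum_eq_sym_sum:
  assumes "distinct xs"
  shows "symmetrised_sum pw lam xs = sym_sum pw lam (set xs)"
proof (cases "length xs < length lam")
  case True
  then show ?thesis
    using assms by (simp add: symmetrised_sum_def sym_sum_eq_0 distinct_card)
next
  case False
  let ?w = "\<lambda>\<omega>. (\<Prod>i<length lam. pw (xs ! \<omega> i) (lam ! i)) *
      (\<Prod>i<length lam. \<Prod>j\<in>{i<..<length xs}. (xs ! \<omega> i + xs ! \<omega> j) / (xs ! \<omega> i - xs ! \<omega> j))"
  have "?w \<omega> = seq_weight pw lam (permute_list \<omega> xs)" if "\<omega> permutes {..<length xs}" for \<omega>
    using False that by (auto simp: seq_weight_def permute_list_nth intro!: arg_cong2[where f="(*)"] prod.cong)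
  then have "(\<Sum>\<omega> | \<omega> permutes {..<length xs}. ?w \<omega>) =
      fact (length xs - length lam) * sym_sum pw lam (set xs)"
    using assms False sum_seq_weight[of "set xs" lam pw]
    by (simp add: sum_permutes_distinct distinct_card)
  then show ?thesis
    using False by (simp add: symmetrised_sum_def Let_def)
qed

text \<open>Symmetric functions restricted to lists of distinct entries, seen as functions of the set of entries.\<close>

definition set_\<Gamma> :: "(rat set \<Rightarrow> rat) set" where
  "set_\<Gamma> = {f. \<exists>g\<in>\<Gamma>. \<forall>xs. distinct xs \<longrightarrow> g xs = f (set xs)}"

lemma set_\<Gamma>I:
  assumes "g \<in> \<Gamma>" "\<And>xs. distinct xs \<Longrightarrow> g xs = f (set xs)"
  shows "f \<in> set_\<Gamma>"
  using assms unfolding set_\<Gamma>_def by blast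

lemma set_\<Gamma>E:
  assumes "f \<in> set_\<Gamma>"
  obtains g where "g \<in> \<Gamma>" "\<And>xs. distinct xs \<Longrightarrow> g xs = f (set xs)"
  using assms unfolding set_\<Gamma>_def by blast

lemma set_\<Gamma>_const: "(\<lambda>_. c) \<in> set_\<Gamma>"
  by (rule set_\<Gamma>I[OF \<Gamma>.const]) simp

lemma set_\<Gamma>_add:
  assumes "f \<in> set_\<Gamma>" "h \<in> set_\<Gamma>"
  shows "(\<lambda>X. f X + h X) \<in> set_\<Gamma>"
proof -
  obtain u v where "u \<in> \<Gamma>" "\<And>xs. distinct xs \<Longrightarrow> u xs = f (set xs)"
      and "v \<in> \<Gamma>" "\<And>xs. distinct xs \<Longrightarrow> v xs = h (set xs)"
    using assms by (elim set_\<Gamma>E) blast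
  then show ?thesis
    by (intro set_\<Gamma>I[of "\<lambda>xs. u xs + v xs"] \<Gamma>.add) auto
qed

lemma set_\<Gamma>_mult:
  assumes "f \<in> set_\<Gamma>" "h \<in> set_\<Gamma>"
  shows "(\<lambda>X. f X * h X) \<in> set_\<Gamma>"
proof -
  obtain u v where "u \<in> \<Gamma>" "\<And>xs. distinct xs \<Longrightarrow> u xs = f (set xs)"
      and "v \<in> \<Gamma>" "\<And>xs. distinct xs \<Longrightarrow> v xs = h (set xs)"
    using assms by (elim set_\<Gamma>E) blast
  then show ?thesis
    by (intro set_\<Gamma>I[of "\<lambda>xs. u xs * v xs"] \<Gamma>.mult) auto
qed

lemma set_\<Gamma>_sum:
  assumes "finite I" "\<And>i. i \<in> I \<Longrightarrow> f i \<in> set_\<Gamma>"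
  shows "(\<lambda>X. \<Sum>i\<in>I. f i X) \<in> set_\<Gamma>"
  using assms by (induction I rule: finite_induct) (auto intro: set_\<Gamma>_const set_\<Gamma>_add)

lemma set_\<Gamma>_cong:
  assumes "f \<in> set_\<Gamma>" "\<And>X. finite X \<Longrightarrow> f X = h X"
  shows "h \<in> set_\<Gamma>"
proof -
  obtain u where "u \<in> \<Gamma>" "\<And>xs. distinct xs \<Longrightarrow> u xs = f (set xs)"
    using assms(1) by (elim set_\<Gamma>E) blast
  then show ?thesis
    using assms(2) by (intro set_\<Gamma>I[of u]) auto
qed

lemma cross_moment_in_set_\<Gamma>: "cross_moment (Suc k) \<in> set_\<Gamma>"
proof -
  have "(\<lambda>xs. 1 / 2 * fps_nth (q_series xs) (Suc k)) \<in> \<Gamma>"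
    by (intro \<Gamma>.mult[OF \<Gamma>.const] q_series_in_\<Gamma>)
  then show ?thesis
    by (rule set_\<Gamma>I) (simp add: q_series_nth)
qed

lemma power_sum_distinct: "distinct xs \<Longrightarrow> power_sum r xs = (\<Sum>x\<in>set xs. x ^ r)"
  by (simp add: power_sum_def sum_list_distinct_conv_sum_set)

lemma power_sum_in_set_\<Gamma>: "odd r \<Longrightarrow> (\<lambda>X. \<Sum>x\<in>X. x ^ r) \<in> set_\<Gamma>"
  by (rule set_\<Gamma>I[OF \<Gamma>.power_sum]) (simp_all add: power_sum_distinct)

text \<open>Lists of terms, with repetitions and unsorted indices allowed, make sums and products
  plain list operations; like terms are collected only in \<open>is_coords_p_coeff\<close>.\<close>

definition expansion :: "(rat \<times> nat list) list \<Rightarrow> symfun" where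
  "expansion L xs = (\<Sum>(c, \<rho>)\<leftarrow>L. c * power_sum_part \<rho> xs)"

lemma expansion_simps [simp]:
  "expansion [] xs = 0"
  "expansion ((c, \<rho>) # L) xs = c * power_sum_part \<rho> xs + expansion L xs"
  "expansion (L @ M) xs = expansion L xs + expansion M xs"
  by (simp_all add: expansion_def)

lemma power_sum_part_simps [simp]:
  "power_sum_part [] xs = 1"
  "power_sum_part (r # \<rho>) xs = power_sum r xs * power_sum_part \<rho> xs"
  "power_sum_part (\<rho> @ \<sigma>) xs = power_sum_part \<rho> xs * power_sum_part \<sigma> xs"
  by (simp_all add: power_sum_part_def)

definition odd_terms :: "(rat \<times> nat list) list \<Rightarrow> bool" where
  "odd_terms L \<longleftrightarrow> (\<forall>(c, \<rho>)\<in>set L. \<forall>r\<in>set \<rho>. odd r)"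

lemma \<Gamma>_expansion:
  assumes "f \<in> \<Gamma>"
  shows "\<exists>L. odd_terms L \<and> f = expansion L"
  using assms
proof (induction f rule: \<Gamma>.induct)
  case (const c)
  show ?case
    by (rule exI[of _ "[(c, [])]"]) (auto simp: odd_terms_def)
next
  case (power_sum r)
  then show ?case
    by (intro exI[of _ "[(1, [r])]"]) (auto simp: odd_terms_def)
next
  case (add f h)
  then obtain L M where "odd_terms L" "f = expansion L" "odd_terms M" "h = expansion M"
    by blast
  then show ?case
    by (intro exI[of _ "L @ M"]) (auto simp: odd_terms_def)
next
  case (mult f h)
  then obtain L M where L: "odd_terms L" "f = expansion L" and M: "odd_terms M" "h = expansion M"
    by blast
  let ?one = "\<lambda>(c, \<rho>). map (\<lambda>(d, \<sigma>). (c * d, \<rho> @ \<sigma>)) M"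
  have one: "expansion (?one (c, \<rho>)) xs = c * power_sum_part \<rho> xs * expansion M xs" for c \<rho> xs
    by (induction M) (auto simp: algebra_simps)
  have "expansion (concat (map ?one L)) xs = expansion L xs * expansion M xs" for xs
  proof (induction L)
    case (Cons a L)
    then show ?case
      using one by (cases a) (simp add: algebra_simps)
  qed simp
  moreover have "odd_terms (concat (map ?one L))"
    using L(1) M(1) by (fastforce simp: odd_terms_def)
  ultimately show ?case
    using L M by (intro exI[of _ "concat (map ?one L)"]) auto
qed

text \<open>The factors \<open>p\<^sub>r (X - {x}) = p\<^sub>r X - x\<^sup>r\<close> are split off one at a time.\<close>

lemma cross_moment_power_sums:
  assumes "\<forall>r\<in>set \<rho>. odd r"
  shows "(\<lambda>X. \<Sum>x\<in>X. x ^ Suc k * cross x (X - {x}) * (\<Prod>r\<leftarrow>\<rho>. \<Sum>y\<in>X - {x}. y ^ r)) \<in> set_\<Gamma>"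
  using assms
proof (induction \<rho> arbitrary: k)
  case Nil
  show ?case
    using cross_moment_in_set_\<Gamma>[of k] by (simp add: cross_moment_def[abs_def])
next
  case (Cons r \<rho>)
  let ?m = "\<lambda>k X. \<Sum>x\<in>X. x ^ Suc k * cross x (X - {x}) * (\<Prod>r\<leftarrow>\<rho>. \<Sum>y\<in>X - {x}. y ^ r)"
  have "(\<lambda>X. (\<Sum>x\<in>X. x ^ r) * ?m k X + (-1) * ?m (k + r) X) \<in> set_\<Gamma>"
    using Cons by (intro set_\<Gamma>_add set_\<Gamma>_mult power_sum_in_set_\<Gamma> set_\<Gamma>_const Cons.IH) auto
  then show ?case
  proof (rule set_\<Gamma>_cong)
    fix X :: "rat set"
    assume "finite X"
    then have "(\<Sum>x\<in>X. x ^ Suc k * cross x (X - {x}) * (\<Prod>r\<leftarrow>r # \<rho>. \<Sum>y\<in>X - {x}. y ^ r)) =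
        (\<Sum>x\<in>X. (\<Sum>x\<in>X. x ^ r) * (x ^ Suc k * cross x (X - {x}) * (\<Prod>r\<leftarrow>\<rho>. \<Sum>y\<in>X - {x}. y ^ r))
          - x ^ Suc (k + r) * cross x (X - {x}) * (\<Prod>r\<leftarrow>\<rho>. \<Sum>y\<in>X - {x}. y ^ r))"
      by (intro sum.cong refl) (simp add: sum_diff1 algebra_simps power_add)
    then show "(\<Sum>x\<in>X. x ^ r) * ?m k X + (-1) * ?m (k + r) X =
        (\<Sum>x\<in>X. x ^ Suc k * cross x (X - {x}) * (\<Prod>r\<leftarrow>r # \<rho>. \<Sum>y\<in>X - {x}. y ^ r))"
      by (simp only: sum_subtractf sum_distrib_left) (simp add: sum_negf)
  qed
qed

text \<open>On finite sets \<open>h\<close> is a linear combination of products of odd power sums,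
  so \<open>cross_moment_power_sums\<close> applies term by term.\<close>

lemma cross_moment_set_\<Gamma>:
  assumes "h \<in> set_\<Gamma>"
  shows "(\<lambda>X. \<Sum>x\<in>X. x ^ Suc k * cross x (X - {x}) * h (X - {x})) \<in> set_\<Gamma>"
proof -
  obtain g where g: "g \<in> \<Gamma>" "\<And>xs. distinct xs \<Longrightarrow> g xs = h (set xs)"
    using set_\<Gamma>E[OF assms] by blast
  obtain L where L: "odd_terms L" "g = expansion L"
    using \<Gamma>_expansion[OF g(1)] by blast
  let ?P = "\<lambda>\<rho> X. \<Prod>r\<leftarrow>\<rho>. \<Sum>y\<in>X. y ^ r"
  have h: "h X = (\<Sum>(c, \<rho>)\<leftarrow>L. c * ?P \<rho> X)" if "finite X" for X
  proof -
    obtain xs where "distinct xs" "set xs = X"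
      using finite_distinct_list[OF \<open>finite X\<close>] by blast
    then show ?thesis
      using g(2)[of xs] L(2) by (auto simp: expansion_def power_sum_part_def power_sum_distinct)
  qed
  have "(\<lambda>X. \<Sum>x\<in>X. x ^ Suc k * cross x (X - {x}) * (\<Sum>(c, \<rho>)\<leftarrow>L. c * ?P \<rho> (X - {x}))) \<in> set_\<Gamma>"
    using L(1)
  proof (induction L)
    case Nil
    then show ?case by (simp add: set_\<Gamma>_const)
  next
    case (Cons a L)
    obtain c \<rho> where a: "a = (c, \<rho>)" by fastforce
    have "(\<lambda>X. c * (\<Sum>x\<in>X. x ^ Suc k * cross x (X - {x}) * ?P \<rho> (X - {x})) +
        (\<Sum>x\<in>X. x ^ Suc k * cross x (X - {x}) * (\<Sum>(c, \<rho>)\<leftarrow>L. c * ?P \<rho> (X - {x})))) \<in> set_\<Gamma>"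
      using Cons a by (intro set_\<Gamma>_add set_\<Gamma>_mult set_\<Gamma>_const cross_moment_power_sums) (auto simp: odd_terms_def)
    then show ?case
      by (rule set_\<Gamma>_cong) (simp add: a sum_distrib_left sum.distrib algebra_simps)
  qed
  then show ?thesis
    by (rule set_\<Gamma>_cong) (auto simp: h intro!: sum.cong)
qed

text \<open>Induction on the parts, expanding the power of the first variable into monomials.
  Divisibility by \<open>x\<close> keeps all exponents positive and so avoids the exceptional moment
  of order 0.\<close>

lemma sym_sum_in_set_\<Gamma>:
  assumes "\<forall>a\<in>set as. \<exists>p. \<forall>x. pw x a = x * poly p x"
  shows "sym_sum pw as \<in> set_\<Gamma>"
  using assms
proof (induction as)
  case Nil
  then show ?case
    using set_\<Gamma>_const[of 1] by (simp add: sym_sum.simps(1)[abs_def])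
next
  case (Cons a as)
  then obtain p where p: "\<And>x. pw x a = x * poly p x"
    by auto
  let ?m = "\<lambda>i X. \<Sum>x\<in>X. x ^ Suc i * cross x (X - {x}) * sym_sum pw as (X - {x})"
  have "(\<lambda>X. \<Sum>i\<le>degree p. coeff p i * ?m i X) \<in> set_\<Gamma>"
    using Cons by (intro set_\<Gamma>_sum set_\<Gamma>_mult set_\<Gamma>_const cross_moment_set_\<Gamma>) auto
  moreover have "(\<Sum>i\<le>degree p. coeff p i * ?m i X) = sym_sum pw (a # as) X" for X
  proof -
    have "(\<Sum>i\<le>degree p. coeff p i * ?m i X) =
        (\<Sum>x\<in>X. \<Sum>i\<le>degree p. coeff p i * (x ^ Suc i * cross x (X - {x}) * sym_sum pw as (X - {x})))"
      unfolding sum_distrib_left by (rule sum.swap)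
    also have "\<dots> = sym_sum pw (a # as) X"
      by (auto simp: p poly_altdef sum_distrib_left sum_distrib_right algebra_simps intro!: sum.cong)
    finally show ?thesis .
  qed
  ultimately show ?case
    by (rule set_\<Gamma>_cong)
qed

section \<open>A symmetric function is determined by its values at distinct variables\<close>

lemma \<Gamma>_line_poly:
  assumes "f \<in> \<Gamma>"
  shows "\<exists>p. \<forall>t. f (map2 (\<lambda>x y. x + t * y) xs ys) = poly p t"
  using assms
proof (induction f rule: \<Gamma>.induct)
  case (const c)
  show ?case by (rule exI[of _ "[:c:]"]) simp
next
  case (power_sum r)
  let ?p = "\<Sum>(x, y)\<leftarrow>zip xs ys. [:x, y:] ^ r"
  have "power_sum r (map (\<lambda>(x, y). x + t * y) zs) = poly (\<Sum>(x, y)\<leftarrow>zs. [:x, y:] ^ r) t" for t zs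
    by (induction zs) (auto simp: power_sum_def)
  then show ?case by blast
next
  case (add f h)
  then show ?case by (metis poly_add)
next
  case (mult f h)
  then show ?case by (metis poly_mult)
qed

text \<open>On the line through \<open>xs\<close> with direction (0, 1, ..., n-1) two entries
  collide only for finitely many parameters \<open>t\<close>. Both functions are polynomial in
  \<open>t\<close> there, so they agree at t = 0 as well.\<close>

lemma \<Gamma>_eq_if_eq_on_distinct:
  assumes "f \<in> \<Gamma>" "g \<in> \<Gamma>" and eq: "\<And>xs. distinct xs \<Longrightarrow> f xs = g xs"
  shows "f = g"
proof
  fix xs :: "rat list"
  let ?n = "length xs"
  let ?line = "\<lambda>t. map2 (\<lambda>x y. x + t * y) xs (map of_nat [0..<?n])"
  obtain p where p: "\<And>t. f (?line t) = poly p t"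
    using \<Gamma>_line_poly[OF assms(1)] by metis
  obtain q where q: "\<And>t. g (?line t) = poly q t"
    using \<Gamma>_line_poly[OF assms(2)] by metis
  let ?bad = "\<Union>i<?n. \<Union>j<?n. {(xs ! i - xs ! j) / (of_nat j - of_nat i)}"
  have dist: "distinct (?line t)" if "t \<notin> ?bad" for t
    unfolding distinct_conv_nth
  proof (intro allI impI)
    fix i j
    assume ij: "i < length (?line t)" "j < length (?line t)" "i \<noteq> j"
    then have "t \<noteq> (xs ! i - xs ! j) / (of_nat j - of_nat i)"
      using that by auto
    then have "t * (of_nat j - of_nat i) \<noteq> xs ! i - xs ! j"
      using ij by (simp add: eq_divide_eq)
    then show "?line t ! i \<noteq> ?line t ! j"
      using ij by (auto simp: algebra_simps)
  qed
  have "poly (p - q) t = 0" if "t \<notin> ?bad" for t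
    using eq[OF dist[OF that]] p[of t] q[of t] by simp
  then have "- ?bad \<subseteq> {t. poly (p - q) t = 0}"
    by blast
  moreover have "infinite (- ?bad)"
    unfolding Compl_eq_Diff_UNIV using infinite_UNIV_char_0[where 'a=rat]
    by (intro Diff_infinite_finite) auto
  ultimately have "p = q"
    using poly_roots_finite[of "p - q"] finite_subset by auto
  moreover have "?line 0 = xs"
    by (intro nth_equalityI) auto
  ultimately show "f xs = g xs"
    using p[of 0] q[of 0] by simp
qed

text \<open>Existence comes from \<open>sym_sum_in_set_\<Gamma>\<close> and uniqueness from
  \<open>\<Gamma>_eq_if_eq_on_distinct\<close>, so the definite description in
  \<open>symmetrised\<close> denotes.\<close>

lemma symmetrised:
  assumes "\<forall>a\<in>set lam. \<exists>p. \<forall>x. pw x a = x * poly p x"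
  shows symmetrised_in_\<Gamma>: "symmetrised pw lam \<in> \<Gamma>"
    and symmetrised_distinct: "distinct xs \<Longrightarrow> symmetrised pw lam xs = sym_sum pw lam (set xs)"
proof -
  obtain g where "g \<in> \<Gamma>" "\<And>xs. distinct xs \<Longrightarrow> g xs = sym_sum pw lam (set xs)"
    using set_\<Gamma>E[OF sym_sum_in_set_\<Gamma>[OF assms]] by blast
  then have g: "g \<in> \<Gamma> \<and> (\<forall>xs. distinct xs \<longrightarrow> g xs = symmetrised_sum pw lam xs)"
    by (simp add: symmetrised_sum_eq_sym_sum)
  have "\<exists>!f. f \<in> \<Gamma> \<and> (\<forall>xs. distinct xs \<longrightarrow> f xs = symmetrised_sum pw lam xs)"
  proof (rule ex1I[of _ g])
    fix f
    assume "f \<in> \<Gamma> \<and> (\<forall>xs. distinct xs \<longrightarrow> f xs = symmetrised_sum pw lam xs)"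
    then show "f = g"
      using g by (intro \<Gamma>_eq_if_eq_on_distinct) simp_all
  qed (rule g)
  from theI'[OF this] show "symmetrised pw lam \<in> \<Gamma>"
      "distinct xs \<Longrightarrow> symmetrised pw lam xs = sym_sum pw lam (set xs)"
    unfolding symmetrised_def[symmetric] by (simp_all add: symmetrised_sum_eq_sym_sum)
qed

section \<open>Coordinates with respect to power sums\<close>

lemma coeff_prod_mset_linear:
  fixes a b :: "nat \<Rightarrow> rat"
  shows "coeff (\<Prod>r\<in>#M. [:a r, b r:]) 0 = (\<Prod>r\<in>#M. a r)"
    and "coeff (\<Prod>r\<in>#M. [:a r, b r:]) (Suc 0) = (\<Sum>r\<in>#M. b r * (\<Prod>s\<in>#M - {#r#}. a s))"
proof (induction M)
  case (add x M)
  {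
    case 1
    show ?case using add by (simp add: coeff_mult)
  next
    case 2
    have "(\<Sum>r\<in>#M. b r * (\<Prod>s\<in>#add_mset x M - {#r#}. a s)) =
        (\<Sum>r\<in>#M. a x * (b r * (\<Prod>s\<in>#M - {#r#}. a s)))"
      by (intro arg_cong[where f = sum_mset] image_mset_cong) (simp add: algebra_simps)
    then show ?case
      using add by (simp add: coeff_mult sum_mset_distrib_left)
  }
qed simp_all

lemma power_sum_append [simp]: "power_sum r (xs @ ys) = power_sum r xs + power_sum r ys"
  by (simp add: power_sum_def)

lemma power_sum_replicate [simp]: "power_sum r (replicate k t) = of_nat k * t ^ r"
  by (simp add: power_sum_def sum_list_replicate)

lemma poly_eq_0_if_zero_on_nat:
  fixes p :: "rat poly"
  assumes "\<And>k. poly p (of_nat k) = 0"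
  shows "p = 0"
proof (rule ccontr)
  assume "p \<noteq> 0"
  then have "finite {x. poly p x = 0}"
    by (rule poly_roots_finite)
  moreover have "range of_nat \<subseteq> {x. poly p x = 0}"
    using assms by auto
  ultimately have "finite (range (of_nat :: nat \<Rightarrow> rat))"
    by (rule rev_finite_subset)
  then show False
    using finite_imageD[of "of_nat :: nat \<Rightarrow> rat" UNIV] by (simp add: inj_on_def)
qed

text \<open>Appending \<open>k\<close> copies of \<open>t\<close> replaces \<open>p\<^sub>r\<close> by \<open>p\<^sub>r + k t\<^sup>r\<close>; the coefficient of \<open>k t\<^sup>r\<close> of the
  given relation is its derivative with respect to \<open>p\<^sub>r\<close>, which has smaller degree.\<close>

lemma power_sums_derivative:
  fixes d :: "nat multiset \<Rightarrow> rat"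
  assumes "finite S" and zero: "\<And>xs. (\<Sum>M\<in>S. d M * (\<Prod>r\<in>#M. power_sum r xs)) = 0"
  shows "(\<Sum>M\<in>S. d M * of_nat (count M r) * (\<Prod>s\<in>#M - {#r#}. power_sum s xs)) = 0"
proof -
  have "(\<Sum>M\<in>S. d M * (\<Sum>s\<in>#M. t ^ s * (\<Prod>u\<in>#M - {#s#}. power_sum u xs))) = 0" for t
  proof -
    let ?p = "\<Sum>M\<in>S. Polynomial.smult (d M) (\<Prod>s\<in>#M. [:power_sum s xs, t ^ s:])"
    have "poly ?p (of_nat k) = 0" for k
    proof -
      have "poly (\<Prod>s\<in>#M. [:power_sum s xs, t ^ s:]) (of_nat k) = (\<Prod>s\<in>#M. power_sum s (xs @ replicate k t))" for M
        by (induction M) (simp_all add: algebra_simps)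
      then show ?thesis
        using zero[of "xs @ replicate k t"] by (simp add: poly_sum)
    qed
    then have "coeff ?p (Suc 0) = 0"
      using poly_eq_0_if_zero_on_nat[of ?p] by simp
    then show ?thesis
      by (simp add: coeff_sum coeff_prod_mset_linear)
  qed
  moreover have "(\<Sum>s\<in>#M. t ^ s * c s) = poly (\<Sum>s\<in>#M. monom (c s) s) t"
    for t :: rat and c and M :: "nat multiset"
    by (induction M) (simp_all add: poly_monom mult.commute)
  ultimately have "(\<Sum>M\<in>S. Polynomial.smult (d M) (\<Sum>s\<in>#M. monom (\<Prod>u\<in>#M - {#s#}. power_sum u xs) s)) = 0"
    by (intro poly_eq_0_if_zero_on_nat) (simp add: poly_sum)
  then have "coeff (\<Sum>M\<in>S. Polynomial.smult (d M) (\<Sum>s\<in>#M. monom (\<Prod>u\<in>#M - {#s#}. power_sum u xs) s)) r = 0"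
    by simp
  moreover have "coeff (\<Sum>s\<in>#M. monom (c s) s) r = of_nat (count M r) * c r"
    for c :: "nat \<Rightarrow> rat" and M :: "nat multiset"
    by (induction M) (auto simp: algebra_simps)
  ultimately show ?thesis
    by (simp add: coeff_sum mult.assoc)
qed

text \<open>Induction on a bound for the degree. A multiset containing \<open>r\<close> survives in
  the derivative with respect to p_r with the nonzero factor \<open>count M r\<close>, and removing
  one \<open>r\<close> is injective on such multisets. The constant term is then isolated by
  evaluating at the empty list.\<close>

lemma power_sums_independent:
  fixes d :: "nat multiset \<Rightarrow> rat"
  assumes "finite S" "\<And>xs. (\<Sum>M\<in>S. d M * (\<Prod>r\<in>#M. power_sum r xs)) = 0" "M \<in> S"
  shows "d M = 0"
proof -
  have "\<forall>M\<in>S. size M \<le> n \<Longrightarrow> M \<in> S \<Longrightarrow> d M = 0" for n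
    using assms(1,2)
  proof (induction n arbitrary: S d M)
    case 0
    then have "S = {{#}}" "M = {#}"
      by auto
    then show ?case
      using "0.prems"(4) by simp
  next
    case (Suc n)
    have nonempty: "d M = 0" if M: "M \<in> S" "M \<noteq> {#}" for M
    proof -
      obtain r where r: "r \<in># M"
        using M(2) by (meson multiset_nonemptyE)
      let ?S = "(\<lambda>M. M - {#r#}) ` {M \<in> S. r \<in># M}"
      let ?d = "\<lambda>N. d (add_mset r N) * of_nat (count (add_mset r N) r)"
      have inj: "inj_on (\<lambda>M. M - {#r#}) {M \<in> S. r \<in># M}"
        by (rule inj_onI) (metis insert_DiffM mem_Collect_eq)
      have "(\<Sum>N\<in>?S. ?d N * (\<Prod>s\<in>#N. power_sum s xs)) = 0" for xs
      proof -
        have "(\<Sum>N\<in>?S. ?d N * (\<Prod>s\<in>#N. power_sum s xs)) =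
            (\<Sum>M | M \<in> S \<and> r \<in># M. d M * of_nat (count M r) * (\<Prod>s\<in>#M - {#r#}. power_sum s xs))"
          by (subst sum.reindex[OF inj]) (simp add: o_def)
        also have "\<dots> = (\<Sum>M\<in>S. d M * of_nat (count M r) * (\<Prod>s\<in>#M - {#r#}. power_sum s xs))"
          using Suc.prems(3) by (intro sum.mono_neutral_left) (auto simp: not_in_iff)
        finally show ?thesis
          using power_sums_derivative[OF Suc.prems(3,4)] by simp
      qed
      moreover have "\<forall>N\<in>?S. size N \<le> n"
        using Suc.prems(1) by (auto simp: size_Diff_singleton)
      ultimately have "?d (M - {#r#}) = 0"
        using M(1) r Suc.prems(3) by (intro Suc.IH[of ?S "M - {#r#}" ?d]) auto
      then show ?thesis
        using r by (auto simp: count_eq_zero_iff)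
    qed
    show ?case
    proof (cases "M = {#}")
      case True
      have "(\<Sum>M\<in>S. d M * (\<Prod>r\<in>#M. power_sum r [])) = (\<Sum>M\<in>{{#}}. d M * (\<Prod>r\<in>#M. power_sum r []))"
        using Suc.prems(2,3) True nonempty by (intro sum.mono_neutral_right) auto
      then show ?thesis
        using Suc.prems(4) True by simp
    qed (use Suc.prems(2) nonempty in blast)
  qed
  from this[of "Max (size ` S)"] show ?thesis
    using assms(1,3) by simp
qed

section \<open>Existence and uniqueness of coordinates in the power sum basis\<close>

lemma power_sum_part_mset: "power_sum_part \<rho> xs = (\<Prod>r\<in>#mset \<rho>. power_sum r xs)"
  by (simp add: power_sum_part_def prod_mset_prod_list[symmetric])

lemma is_partition_mset_eqD:
  assumes "is_partition \<rho>" "is_partition \<sigma>" "mset \<rho> = mset \<sigma>"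
  shows "\<rho> = \<sigma>"
proof -
  have "sorted (rev \<rho>)" "sorted (rev \<sigma>)"
    using assms by (simp_all add: is_partition_def sorted_wrt_rev)
  moreover have "mset (rev \<rho>) = mset (rev \<sigma>)"
    using assms(3) by simp
  ultimately have "rev \<rho> = rev \<sigma>"
    by (metis properties_for_sort)
  then show ?thesis by simp
qed

text \<open>The predicate inside the definite description of \<open>p_coeff\<close>.\<close>

definition is_coords :: "symfun \<Rightarrow> (nat list \<Rightarrow> rat) \<Rightarrow> bool" where
  "is_coords f c \<longleftrightarrow> finite {\<rho>. c \<rho> \<noteq> 0} \<and> (\<forall>\<rho>. c \<rho> \<noteq> 0 \<longrightarrow> odd_partition \<rho>) \<and>
     (\<forall>xs. f xs = (\<Sum>\<rho> | c \<rho> \<noteq> 0. c \<rho> * power_sum_part \<rho> xs))"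

lemma is_coordsI:
  assumes "finite T" "\<And>\<rho>. c \<rho> \<noteq> 0 \<Longrightarrow> \<rho> \<in> T" "\<And>\<rho>. c \<rho> \<noteq> 0 \<Longrightarrow> odd_partition \<rho>"
    and "\<And>xs. f xs = (\<Sum>\<rho>\<in>T. c \<rho> * power_sum_part \<rho> xs)"
  shows "is_coords f c"
proof -
  have "(\<Sum>\<rho> | c \<rho> \<noteq> 0. c \<rho> * power_sum_part \<rho> xs) = (\<Sum>\<rho>\<in>T. c \<rho> * power_sum_part \<rho> xs)" for xs
    using assms(1,2) by (intro sum.mono_neutral_left) auto
  then show ?thesis
    unfolding is_coords_def using assms by (auto intro: finite_subset[of _ T])
qed

lemma is_coordsD:
  assumes "is_coords f c" "finite T" "\<And>\<rho>. c \<rho> \<noteq> 0 \<Longrightarrow> \<rho> \<in> T"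
  shows "f xs = (\<Sum>\<rho>\<in>T. c \<rho> * power_sum_part \<rho> xs)"
proof -
  have "f xs = (\<Sum>\<rho> | c \<rho> \<noteq> 0. c \<rho> * power_sum_part \<rho> xs)"
    using assms(1) by (simp add: is_coords_def)
  also have "\<dots> = (\<Sum>\<rho>\<in>T. c \<rho> * power_sum_part \<rho> xs)"
    using assms(2,3) by (intro sum.mono_neutral_left) auto
  finally show ?thesis .
qed

text \<open>A partition is determined by the multiset of its parts, so the difference of two
  coordinate families is a relation between monomials indexed by multisets, to which independence
  applies.\<close>

lemma is_coords_unique:
  assumes c: "is_coords f c" and d: "is_coords f d"
  shows "c = d"
proof
  fix \<rho>
  let ?T = "{\<rho>. c \<rho> \<noteq> 0} \<union> {\<rho>. d \<rho> \<noteq> 0}"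
  have fin: "finite ?T" and part: "\<And>\<rho>. \<rho> \<in> ?T \<Longrightarrow> is_partition \<rho>"
    using c d by (auto simp: is_coords_def odd_partition_def)
  have inj: "inj_on mset ?T"
    by (rule inj_onI) (rule is_partition_mset_eqD[OF part part])
  let ?e = "\<lambda>M. c (inv_into ?T mset M) - d (inv_into ?T mset M)"
  have "(\<Sum>M\<in>mset ` ?T. ?e M * (\<Prod>r\<in>#M. power_sum r xs)) = 0" for xs
  proof -
    have "(\<Sum>M\<in>mset ` ?T. ?e M * (\<Prod>r\<in>#M. power_sum r xs)) =
        (\<Sum>\<rho>\<in>?T. c \<rho> * power_sum_part \<rho> xs - d \<rho> * power_sum_part \<rho> xs)"
      unfolding sum.reindex[OF inj] o_def
      by (intro sum.cong refl) (simp only: inv_into_f_f[OF inj] power_sum_part_mset left_diff_distrib)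
    also have "\<dots> = f xs - f xs"
      unfolding sum_subtractf
      using is_coordsD[OF c fin, of xs] is_coordsD[OF d fin, of xs] by auto
    finally show ?thesis by simp
  qed
  then have "?e (mset \<rho>) = 0" if "\<rho> \<in> ?T"
    using fin that by (intro power_sums_independent[of "mset ` ?T" ?e]) auto
  then show "c \<rho> = d \<rho>"
    using inv_into_f_f[OF inj, of \<rho>] by (cases "\<rho> \<in> ?T") auto
qed

lemma p_coeff_eqI: "is_coords f c \<Longrightarrow> p_coeff f = c"
  unfolding p_coeff_def is_coords_def[symmetric] using is_coords_unique by blast

lemma is_coords_p_coeff:
  assumes "f \<in> \<Gamma>"
  shows "is_coords f (p_coeff f)"
proof -
  obtain L where L: "odd_terms L" "f = expansion L"
    using \<Gamma>_expansion[OF assms] by blast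
  let ?canon = "\<lambda>\<rho> :: nat list. rev (sort \<rho>)"
  let ?T = "?canon ` snd ` set L"
  let ?c = "\<lambda>\<rho>. \<Sum>(d, \<sigma>)\<leftarrow>L. if ?canon \<sigma> = \<rho> then d else 0"
  have supp: "\<rho> \<in> ?T" if "?c \<rho> \<noteq> 0" for \<rho>
  proof (rule ccontr)
    assume "\<rho> \<notin> ?T"
    then have "?c \<rho> = (\<Sum>(d, \<sigma>)\<leftarrow>L. 0)"
      by (intro arg_cong[where f = sum_list] map_cong refl) (auto simp: image_iff)
    also have "\<dots> = 0"
      by (induction L) auto
    finally show False
      using that by simp
  qed
  have odd: "odd_partition \<rho>" if "\<rho> \<in> ?T" for \<rho>
  proof -
    have "\<forall>r\<in>set \<rho>. odd r"
      using that L(1) by (auto simp: odd_terms_def)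
    moreover have "sorted_wrt (\<ge>) \<rho>"
      using that by (auto simp: sorted_wrt_rev)
    ultimately show ?thesis
      by (auto simp: odd_partition_def is_partition_def)
  qed
  have "f xs = (\<Sum>\<rho>\<in>?T. ?c \<rho> * power_sum_part \<rho> xs)" for xs
  proof -
    \<comment> \<open>The index set \<open>T\<close> is only required to contain the sorted indices,
      so that it can stay fixed while the list of terms shrinks.\<close>
    have "expansion M xs = (\<Sum>\<rho>\<in>T. (\<Sum>(d, \<sigma>)\<leftarrow>M. if ?canon \<sigma> = \<rho> then d else 0) * power_sum_part \<rho> xs)"
      if "finite T" "?canon ` snd ` set M \<subseteq> T" for M T
      using that(2)
    proof (induction M)
      case (Cons a M)
      obtain d \<sigma> where a: "a = (d, \<sigma>)" by fastforce
      have "(\<Sum>\<rho>\<in>T. (if ?canon \<sigma> = \<rho> then d else 0) * power_sum_part \<rho> xs) = d * power_sum_part (?canon \<sigma>) xs"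
        using \<open>finite T\<close> Cons.prems a by (simp add: if_distrib[of "\<lambda>x. x * _"] cong: if_cong)
      also have "power_sum_part (?canon \<sigma>) xs = power_sum_part \<sigma> xs"
        by (simp add: power_sum_part_mset)
      finally show ?case
        using Cons a by (simp add: distrib_right sum.distrib)
    qed simp
    then show ?thesis
      using L(2) by simp
  qed
  then have "is_coords f ?c"
    using supp odd by (intro is_coordsI[of ?T]) auto
  then show ?thesis
    using p_coeff_eqI by metis
qed

lemma p_coeff_power_sum_part:
  assumes "odd_partition \<rho>"
  shows "p_coeff (power_sum_part \<rho>) = (\<lambda>\<sigma>. of_bool (\<sigma> = \<rho>))"
  using assms by (intro p_coeff_eqI is_coordsI[of "{\<rho>}"]) auto

lemma p_coeff_linear:
  assumes "finite I" "\<And>i. i \<in> I \<Longrightarrow> f i \<in> \<Gamma>"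
  shows "p_coeff (\<lambda>xs. \<Sum>i\<in>I. a i * f i xs) \<rho> = (\<Sum>i\<in>I. a i * p_coeff (f i) \<rho>)"
proof -
  let ?T = "\<Union>i\<in>I. {\<rho>. p_coeff (f i) \<rho> \<noteq> 0}"
  have coords: "is_coords (f i) (p_coeff (f i))" if "i \<in> I" for i
    using assms(2) is_coords_p_coeff that by blast
  have fin: "finite ?T"
    using assms(1) coords by (auto simp: is_coords_def)
  have "is_coords (\<lambda>xs. \<Sum>i\<in>I. a i * f i xs) (\<lambda>\<rho>. \<Sum>i\<in>I. a i * p_coeff (f i) \<rho>)"
  proof (rule is_coordsI[OF fin])
    fix \<rho>
    assume "(\<Sum>i\<in>I. a i * p_coeff (f i) \<rho>) \<noteq> 0"
    then obtain i where i: "i \<in> I" "p_coeff (f i) \<rho> \<noteq> 0"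
      by (metis (no_types, lifting) mult_zero_right sum.neutral)
    then show "\<rho> \<in> ?T" by blast
    show "odd_partition \<rho>"
      using i coords[of i] by (auto simp: is_coords_def)
  next
    fix xs
    have "(\<Sum>i\<in>I. a i * f i xs) = (\<Sum>i\<in>I. \<Sum>\<rho>\<in>?T. a i * p_coeff (f i) \<rho> * power_sum_part \<rho> xs)"
    proof (intro sum.cong refl)
      fix i
      assume "i \<in> I"
      then have "f i xs = (\<Sum>\<rho>\<in>?T. p_coeff (f i) \<rho> * power_sum_part \<rho> xs)"
        by (intro is_coordsD[OF coords fin]) auto
      then show "a i * f i xs = (\<Sum>\<rho>\<in>?T. a i * p_coeff (f i) \<rho> * power_sum_part \<rho> xs)"
        by (simp add: sum_distrib_left mult.assoc)
    qed
    also have "\<dots> = (\<Sum>\<rho>\<in>?T. (\<Sum>i\<in>I. a i * p_coeff (f i) \<rho>) * power_sum_part \<rho> xs)"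
      unfolding sum_distrib_right by (rule sum.swap)
    finally show "(\<Sum>i\<in>I. a i * f i xs) = \<dots>" .
  qed
  then show ?thesis
    by (simp add: p_coeff_eqI)
qed

text \<open>Multiplication by p_1 appends a part 1 to every index; as 1 is the smallest possible
  part, the result is again weakly decreasing. Hence all coordinates of the product sit at
  partitions with a part 1.\<close>

lemma p_coeff_power_sum_1_mult:
  assumes f: "f \<in> \<Gamma>" and \<rho>: "1 \<notin> set \<rho>"
  shows "p_coeff (\<lambda>xs. power_sum 1 xs * f xs) \<rho> = 0"
proof -
  let ?T = "{\<sigma>. p_coeff f \<sigma> \<noteq> 0}" and ?snoc = "\<lambda>\<sigma>. \<sigma> @ [1 :: nat]"
  let ?c = "\<lambda>\<rho>. if \<rho> \<in> ?snoc ` ?T then p_coeff f (butlast \<rho>) else 0"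
  have coords: "is_coords f (p_coeff f)"
    using f by (rule is_coords_p_coeff)
  have "is_coords (\<lambda>xs. power_sum 1 xs * f xs) ?c"
  proof (rule is_coordsI[of "?snoc ` ?T"])
    show "finite (?snoc ` ?T)"
      using coords by (simp add: is_coords_def)
  next
    fix \<rho>
    assume "?c \<rho> \<noteq> 0"
    then show "\<rho> \<in> ?snoc ` ?T"
      by (metis (no_types, lifting))
    then obtain \<sigma> where \<sigma>: "\<rho> = \<sigma> @ [1]" "p_coeff f \<sigma> \<noteq> 0"
      by blast
    then have "odd_partition \<sigma>"
      using coords by (simp add: is_coords_def)
    then show "odd_partition \<rho>"
      by (auto simp: \<sigma>(1) odd_partition_def is_partition_def sorted_wrt_append Suc_le_eq intro: gr0I)
  next
    fix xs
    have "power_sum 1 xs * f xs = power_sum 1 xs * (\<Sum>\<sigma>\<in>?T. p_coeff f \<sigma> * power_sum_part \<sigma> xs)"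
      using coords by (simp add: is_coords_def)
    also have "\<dots> = (\<Sum>\<sigma>\<in>?T. p_coeff f \<sigma> * power_sum_part (\<sigma> @ [1]) xs)"
      by (simp add: sum_distrib_left mult_ac)
    also have "\<dots> = (\<Sum>\<rho>\<in>?snoc ` ?T. ?c \<rho> * power_sum_part \<rho> xs)"
      by (subst sum.reindex) (auto simp: inj_on_def intro!: sum.cong)
    finally show "power_sum 1 xs * f xs = \<dots>" .
  qed
  then show ?thesis
    using \<rho> by (auto simp: p_coeff_eqI)
qed

lemma scalar_product_power_sum_part:
  assumes "odd_partition \<rho>"
  shows "scalar_product (power_sum_part \<rho>) h = p_coeff h \<rho> * (z_factor \<rho> / 2 ^ length \<rho>)"
  unfolding scalar_product_def p_coeff_power_sum_part[OF assms] by simp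

section \<open>Pieri rule and vanishing\<close>

text \<open>Exchanging the variables \<open>x\<close> and \<open>y\<close> given to the two equal
  parts only changes the sign of (x + y) / (x - y), so the terms cancel in pairs.\<close>

lemma sym_sum_adjacent_eq:
  assumes "finite X"
  shows "sym_sum pw (as @ a # a # bs) X = 0"
  using assms
proof (induction as arbitrary: X)
  case Nil
  define F where "F x y = pw x a * cross x (X - {x}) *
      (pw y a * cross y (X - {x} - {y}) * sym_sum pw bs (X - {x} - {y}))" for x y
  have anti: "F x y = - F y x" if "x \<in> X" "y \<in> X" "x \<noteq> y" for x y
  proof -
    have *: "cross u (X - {u}) = (u + v) / (u - v) * cross u (X - {u} - {v})"
      if "v \<in> X" "v \<noteq> u" for u v
      using cross_insert[of "X - {u} - {v}" v u] Nil that
      by (simp add: insert_absorb insert_Diff_if[symmetric] insert_Diff)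
    have "X - {y} - {x} = X - {x} - {y}" "c / (x - y) = - (c / (y - x))" for c
      using minus_divide_right[of c "x - y"] by auto
    then show ?thesis
      using that *[of y x] *[of x y] by (simp add: F_def add.commute mult_ac)
  qed
  have "(\<Sum>x\<in>X. \<Sum>y\<in>X - {x}. F x y) = (\<Sum>x\<in>X. \<Sum>y | y \<in> X \<and> x \<noteq> y. F x y)"
    by (intro sum.cong refl) auto
  also have "\<dots> = (\<Sum>y\<in>X. \<Sum>x | x \<in> X \<and> x \<noteq> y. F x y)"
    using Nil by (intro sum.swap_restrict) auto
  also have "\<dots> = (\<Sum>y\<in>X. \<Sum>x\<in>X - {y}. - F y x)"
    by (intro sum.cong refl) (auto intro: anti)
  also have "\<dots> = - (\<Sum>x\<in>X. \<Sum>y\<in>X - {x}. F x y)"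
    by (simp only: sum_negf)
  finally show ?case
    by (simp add: F_def sum_distrib_left)
qed simp

text \<open>The value c = 0 covers powers, c = 1 falling factorials. If \<open>x\<close> receives
  the first part \<open>a\<close>, the factor on the left splits into x - c a, which raises
  \<open>a\<close> to \<open>a + 1\<close>, and the corresponding factor for the remaining parts and
  variables. The new part 1 comes from the empty list, through
  \<open>cross_moment_1\<close>.\<close>

lemma sym_sum_pieri:
  assumes pw: "\<And>x. pw x 0 = 1" "\<And>x k. pw x (Suc k) = (x - c * of_nat k) * pw x k"
    and "finite X"
  shows "(\<Sum>X - c * of_nat (sum_list as)) * sym_sum pw as X =
    (\<Sum>i<length as. sym_sum pw (as[i := Suc (as ! i)]) X) + sym_sum pw (as @ [1]) X"
  using assms(3)
proof (induction as arbitrary: X)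
  case Nil
  then show ?case
    using cross_moment_1[OF Nil] pw(2)[of _ 0] by (simp add: cross_moment_def pw(1))
next
  case (Cons a as)
  let ?c = "\<lambda>x. cross x (X - {x})"
  have "(\<Sum>X - c * of_nat (sum_list (a # as))) * sym_sum pw (a # as) X =
      (\<Sum>x\<in>X. pw x (Suc a) * ?c x * sym_sum pw as (X - {x}) +
        pw x a * ?c x * ((\<Sum>(X - {x}) - c * of_nat (sum_list as)) * sym_sum pw as (X - {x})))"
    unfolding sym_sum.simps sum_distrib_left using Cons.prems
    by (intro sum.cong refl) (simp add: pw(2) sum_diff1 algebra_simps)
  also have "\<dots> = (\<Sum>x\<in>X. pw x (Suc a) * ?c x * sym_sum pw as (X - {x})) +
      (\<Sum>x\<in>X. \<Sum>i<length as. pw x a * ?c x * sym_sum pw (as[i := Suc (as ! i)]) (X - {x})) +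
      (\<Sum>x\<in>X. pw x a * ?c x * sym_sum pw (as @ [1]) (X - {x}))"
    using Cons.prems
    by (simp add: Cons.IH distrib_left sum.distrib sum_distrib_left add.assoc)
  also have "(\<Sum>x\<in>X. \<Sum>i<length as. pw x a * ?c x * sym_sum pw (as[i := Suc (as ! i)]) (X - {x})) =
      (\<Sum>i<length as. sym_sum pw ((a # as)[Suc i := Suc ((a # as) ! Suc i)]) X)"
    by (subst sum.swap) simp
  finally show ?case
    by (simp add: sum.lessThan_Suc_shift del: sum.lessThan_Suc)
qed

section \<open>Vanishing of the falling factorial sums at small sets of integers\<close>

lemma falling_0 [simp]: "falling x 0 = 1"
  by (simp add: falling_def)

lemma falling_Suc: "falling x (Suc k) = (x - of_nat k) * falling x k"
  by (simp add: falling_def)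

lemma falling_of_nat_eq_0: "n < k \<Longrightarrow> falling (of_nat n) k = 0"
  by (auto simp: falling_def)

lemma falling_poly:
  assumes "k > 0"
  shows "\<exists>p. \<forall>x. falling x k = x * poly p x"
proof -
  have "falling x (Suc k) = x * poly (\<Prod>i<k. [:- of_nat (Suc i), 1:]) x" for x k
    unfolding falling_def prod.lessThan_Suc_shift by (simp add: poly_prod del: of_nat_Suc)
  then show ?thesis
    using assms by (metis gr0_implies_Suc)
qed

text \<open>In a nonzero term every variable is at least the part it receives. The first i + 1 parts
  are all at least \<open>as ! i\<close>, so such a term would use i + 1 elements of
  \<open>A\<close> that are at least \<open>as ! i\<close>.\<close>

lemma sym_sum_falling_eq_0:
  assumes "finite A" "sorted_wrt (\<ge>) as" "i < length as" "card {x\<in>A. as ! i \<le> x} \<le> i"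
  shows "sym_sum falling as (of_nat ` A) = 0"
  using assms
proof (induction as arbitrary: A i)
  case (Cons a as)
  have "falling x a * sym_sum falling as (of_nat ` A - {x}) = 0" if x: "x \<in> of_nat ` A" for x
  proof -
    obtain n where n: "x = of_nat n" "n \<in> A"
      using x by blast
    have image: "of_nat ` A - {x} = (of_nat ` (A - {n}) :: rat set)"
      using n by auto
    show ?thesis
    proof (cases "n < a")
      case True
      then show ?thesis by (simp add: n falling_of_nat_eq_0)
    next
      case False
      show ?thesis
      proof (cases i)
        case 0
        then have "{x\<in>A. a \<le> x} = {}"
          using Cons.prems by simp
        then show ?thesis
          using False n by auto
      next
        case (Suc j)
        have "as ! j \<le> a"
          using Cons.prems Suc by simp
        \<comment> \<open>The variable \<open>n\<close> just used is itself counted, since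
          \<open>as ! j\<close> \<le> \<open>a\<close> \<le> \<open>n\<close>; its removal lowers
          the count by one.\<close>
        then have "{x\<in>A. as ! j \<le> x} = insert n {x\<in>A - {n}. as ! j \<le> x}"
          using False n by auto
        then have "card {x\<in>A - {n}. as ! j \<le> x} \<le> j"
          using Cons.prems Suc by simp
        then have "sym_sum falling as (of_nat ` (A - {n})) = 0"
          using Cons.prems Suc by (intro Cons.IH[of _ j]) auto
        then show ?thesis
          by (simp add: image)
      qed
    qed
  qed
  then show ?case
    by (force simp: intro!: sum.neutral)
qed simp

section \<open>The lattice of strict partitions\<close>

text \<open>Rows are counted from 0, and the value is 0 beyond the last row, so that lengthening a
  row and opening a new one become the same operation.\<close>

definition row_length :: "nat list \<Rightarrow> nat \<Rightarrow> nat" where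
  "row_length lam r = (if r < length lam then lam ! r else 0)"

lemma shifted_diagram_row_length:
  "shifted_diagram lam = {(Suc r, c) | r c. Suc r \<le> c \<and> c \<le> row_length lam r + r}"
proof -
  have "(i, c) \<in> shifted_diagram lam \<longleftrightarrow> (\<exists>r. i = Suc r \<and> Suc r \<le> c \<and> c \<le> row_length lam r + r)" for i c
    by (cases i) (auto simp: shifted_diagram_def row_length_def)
  then show ?thesis
    by auto
qed

lemma Suc_mem_shifted_diagram_iff:
  "(Suc r, c) \<in> shifted_diagram lam \<longleftrightarrow> c \<in> {r<..row_length lam r + r}"
  by (auto simp: shifted_diagram_row_length)

lemma zero_notin_shifted_diagram: "(0, c) \<notin> shifted_diagram lam"
  by (simp add: shifted_diagram_row_length)

text \<open>Every row of a shifted diagram is an interval starting on the diagonal. One extra box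
  therefore increases the cardinality of exactly one row by 1, and conversely the lengths determine
  the intervals.\<close>

lemma adds_one_box_iff_row_length:
  "adds_one_box \<kappa> \<nu> \<longleftrightarrow> (\<exists>r. row_length \<nu> = (row_length \<kappa>)(r := Suc (row_length \<kappa> r)))"
proof
  assume "adds_one_box \<kappa> \<nu>"
  then obtain i c where b: "(i, c) \<notin> shifted_diagram \<kappa>"
      "shifted_diagram \<nu> = insert (i, c) (shifted_diagram \<kappa>)"
    unfolding adds_one_box_def by auto
  obtain r where r: "i = Suc r"
    using b(2) zero_notin_shifted_diagram[of c \<nu>] by (cases i) auto
  have rows: "{s<..row_length \<nu> s + s} =
      (if s = r then insert c {s<..row_length \<kappa> s + s} else {s<..row_length \<kappa> s + s})" for s
    using b(2) by (auto simp: r set_eq_iff Suc_mem_shifted_diagram_iff[symmetric] simp del: greaterThanAtMost_iff)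
  have "c \<notin> {r<..row_length \<kappa> r + r}"
    using b(1) by (simp add: r Suc_mem_shifted_diagram_iff)
  then have "row_length \<nu> s = ((row_length \<kappa>)(r := Suc (row_length \<kappa> r))) s" for s
    using arg_cong[OF rows[of s], of card] by (cases "s = r") auto
  then show "\<exists>r. row_length \<nu> = (row_length \<kappa>)(r := Suc (row_length \<kappa> r))"
    by blast
next
  assume "\<exists>r. row_length \<nu> = (row_length \<kappa>)(r := Suc (row_length \<kappa> r))"
  then obtain r where r: "row_length \<nu> = (row_length \<kappa>)(r := Suc (row_length \<kappa> r))" ..
  let ?b = "(Suc r, Suc (row_length \<kappa> r + r))"
  have "p \<in> shifted_diagram \<nu> \<longleftrightarrow> p = ?b \<or> p \<in> shifted_diagram \<kappa>" for p
  proof (cases p)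
    case (Pair i c)
    then show ?thesis
      by (cases i) (auto simp: zero_notin_shifted_diagram Suc_mem_shifted_diagram_iff r)
  qed
  moreover have "?b \<notin> shifted_diagram \<kappa>"
    by (simp add: Suc_mem_shifted_diagram_iff)
  ultimately show "adds_one_box \<kappa> \<nu>"
    unfolding adds_one_box_def by blast
qed

lemma row_length_inject:
  assumes "0 \<notin> set \<kappa>" "0 \<notin> set \<nu>" "row_length \<kappa> = row_length \<nu>"
  shows "\<kappa> = \<nu>"
proof -
  have "r < length lam \<longleftrightarrow> row_length lam r \<noteq> 0" if "0 \<notin> set lam" for r lam
    using that by (auto simp: row_length_def in_set_conv_nth)
  then have "r < length \<kappa> \<longleftrightarrow> r < length \<nu>" for r
    using assms by metis
  then have "length \<kappa> = length \<nu>"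
    by (metis linorder_neq_iff)
  then show ?thesis
    using assms(3) by (intro nth_equalityI) (auto simp: row_length_def fun_eq_iff split: if_splits)
qed

lemma adds_one_box_iff_list:
  assumes "0 \<notin> set \<kappa>" "0 \<notin> set \<nu>"
  shows "adds_one_box \<kappa> \<nu> \<longleftrightarrow>
    \<nu> \<in> (\<lambda>i. \<kappa>[i := Suc (\<kappa> ! i)]) ` {..<length \<kappa>} \<union> {\<kappa> @ [1]}" (is "_ \<longleftrightarrow> \<nu> \<in> ?C")
proof -
  have upd: "row_length (\<kappa>[i := Suc (\<kappa> ! i)]) = (row_length \<kappa>)(i := Suc (row_length \<kappa> i))"
    if "i < length \<kappa>" for i
    using that by (auto simp: row_length_def)
  have app: "row_length (\<kappa> @ [1]) = (row_length \<kappa>)(length \<kappa> := Suc (row_length \<kappa> (length \<kappa>)))"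
    by (auto simp: row_length_def nth_append)
  show ?thesis
    unfolding adds_one_box_iff_row_length
  proof
    assume "\<exists>r. row_length \<nu> = (row_length \<kappa>)(r := Suc (row_length \<kappa> r))"
    then obtain r where r: "row_length \<nu> = (row_length \<kappa>)(r := Suc (row_length \<kappa> r))" ..
    show "\<nu> \<in> ?C"
    proof (cases "r < length \<kappa>")
      case True
      have "0 \<notin> set (\<kappa>[r := Suc (\<kappa> ! r)])"
        using assms(1) set_update_subset_insert[of \<kappa> r "Suc (\<kappa> ! r)"] by auto
      then have "\<nu> = \<kappa>[r := Suc (\<kappa> ! r)]"
        using assms upd[OF True] r by (intro row_length_inject) auto
      then show ?thesis
        using True by auto
    next
      case False
      have "row_length \<nu> r \<noteq> 0"
        by (simp add: r)
      then have "r < length \<nu>"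
        by (simp add: row_length_def split: if_splits)
      \<comment> \<open>A box in a row further down would leave row \<open>length \<kappa>\<close>
        empty although \<open>\<nu>\<close> reaches beyond it, giving \<open>\<nu>\<close> a part
        0.\<close>
      have "r = length \<kappa>"
      proof (rule ccontr)
        assume "r \<noteq> length \<kappa>"
        then have "row_length \<nu> (length \<kappa>) = 0" "length \<kappa> < length \<nu>"
          using r False \<open>r < length \<nu>\<close> by (auto simp: row_length_def)
        then have "\<nu> ! length \<kappa> = 0"
          by (simp add: row_length_def)
        then show False
          using assms(2) \<open>length \<kappa> < length \<nu>\<close> nth_mem by metis
      qed
      then have "\<nu> = \<kappa> @ [1]"
        using assms app r by (intro row_length_inject) auto
      then show ?thesis by simp
    qed
  next
    assume "\<nu> \<in> ?C"
    then show "\<exists>r. row_length \<nu> = (row_length \<kappa>)(r := Suc (row_length \<kappa> r))"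
      using upd app by auto
  qed
qed

section \<open>Strict partitions as sets of parts; covers as moves on these sets\<close>

lemma strict_partition_iff: "strict_partition lam \<longleftrightarrow> sorted_wrt (>) lam \<and> 0 \<notin> set lam"
proof -
  have "sorted_wrt (\<ge>) lam \<and> distinct lam \<longleftrightarrow> sorted_wrt (>) lam"
    by (induction lam) (auto simp: less_le)
  then show ?thesis
    by (auto simp: strict_partition_def is_partition_def)
qed

lemma strict_partition_eqI:
  assumes "strict_partition \<kappa>" "strict_partition \<nu>" "set \<kappa> = set \<nu>"
  shows "\<kappa> = \<nu>"
proof -
  have "sorted_wrt (<) (rev \<kappa>)" "sorted_wrt (<) (rev \<nu>)"
    using assms by (simp_all add: strict_partition_iff sorted_wrt_rev)
  then have "rev \<kappa> = rev \<nu>"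
    using assms(3) by (intro strict_sorted_equal) simp_all
  then show ?thesis by simp
qed

definition partition_of :: "nat set \<Rightarrow> nat list" where
  "partition_of A = rev (sorted_list_of_set A)"

lemma set_partition_of [simp]: "finite A \<Longrightarrow> set (partition_of A) = A"
  by (simp add: partition_of_def)

lemma strict_partition_of: "finite A \<Longrightarrow> 0 \<notin> A \<Longrightarrow> strict_partition (partition_of A)"
  by (simp add: strict_partition_iff partition_of_def sorted_wrt_rev)

lemma partition_of_set: "strict_partition lam \<Longrightarrow> partition_of (set lam) = lam"
  using strict_partition_of[of "set lam"]
  by (intro strict_partition_eqI) (auto simp: strict_partition_iff)

definition up :: "nat list \<Rightarrow> nat list set" where
  "up \<kappa> = {\<nu>. strict_partition \<nu> \<and> adds_one_box \<kappa> \<nu>}"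

definition down :: "nat list \<Rightarrow> nat list set" where
  "down \<nu> = {\<kappa>. strict_partition \<kappa> \<and> \<nu> \<in> up \<kappa>}"

lemma up_strict: "\<nu> \<in> up \<kappa> \<Longrightarrow> strict_partition \<nu>"
  by (simp add: up_def)

lemma down_strict: "\<kappa> \<in> down \<nu> \<Longrightarrow> strict_partition \<kappa>"
  by (simp add: down_def)

lemma up_eq:
  assumes "strict_partition \<kappa>"
  shows "up \<kappa> = {\<nu> \<in> (\<lambda>i. \<kappa>[i := Suc (\<kappa> ! i)]) ` {..<length \<kappa>} \<union> {\<kappa> @ [1]}. strict_partition \<nu>}"
  using assms unfolding up_def strict_partition_iff by (auto simp: adds_one_box_iff_list)

lemma sum_list_up:
  assumes "strict_partition \<kappa>" "\<nu> \<in> up \<kappa>"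
  shows "sum_list \<nu> = Suc (sum_list \<kappa>)"
  using assms by (auto simp: up_eq sum_list_update elem_le_sum_list)

text \<open>On sets of parts, the move \<open>a\<close> replaces the part \<open>a\<close> by \<open>a + 1\<close>; the move \<open>0\<close> creates a
  new part \<open>1\<close>.\<close>

definition up_moves :: "nat set \<Rightarrow> nat set" where
  "up_moves A = {a. (a = 0 \<or> a \<in> A) \<and> Suc a \<notin> A}"

definition down_moves :: "nat set \<Rightarrow> nat set" where
  "down_moves A = {a. Suc a \<in> A \<and> a \<notin> A}"

definition move_up :: "nat \<Rightarrow> nat set \<Rightarrow> nat set" where
  "move_up a A = insert (Suc a) (A - {a})"

text \<open>Removing 0 from the added element makes the move 0 delete the part 1 instead of turning
  it into a part 0.\<close>

definition move_down :: "nat \<Rightarrow> nat set \<Rightarrow> nat set" where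
  "move_down a A = (A - {Suc a}) \<union> ({a} - {0})"

lemma finite_moves [simp]:
  assumes "finite A"
  shows "finite (up_moves A)" "finite (down_moves A)" "finite (move_up a A)" "finite (move_down a A)"
proof -
  have "up_moves A \<subseteq> insert 0 A" "down_moves A \<subseteq> (\<lambda>a. a - 1) ` A"
    by (force simp: up_moves_def down_moves_def)+
  then show "finite (up_moves A)" "finite (down_moves A)"
    using assms by (auto intro: finite_subset)
qed (use assms in \<open>auto simp: move_up_def move_down_def\<close>)

lemma move_down_move_up:
  assumes "0 \<notin> A" "a \<in> up_moves A"
  shows "a \<in> down_moves (move_up a A)" "move_down a (move_up a A) = A" "0 \<notin> move_up a A"
  using assms by (auto simp: up_moves_def down_moves_def move_up_def move_down_def)

lemma move_up_move_down:
  assumes "0 \<notin> A" "a \<in> down_moves A"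
  shows "a \<in> up_moves (move_down a A)" "move_up a (move_down a A) = A" "0 \<notin> move_down a A"
  using assms by (auto simp: up_moves_def down_moves_def move_up_def move_down_def)

lemma mem_up_iff:
  assumes \<kappa>: "strict_partition \<kappa>" and \<nu>: "strict_partition \<nu>"
  shows "\<nu> \<in> up \<kappa> \<longleftrightarrow> (\<exists>a\<in>up_moves (set \<kappa>). set \<nu> = move_up a (set \<kappa>))"
proof
  have dist: "distinct \<kappa>" "distinct \<nu>" and pos: "0 \<notin> set \<kappa>"
    using assms by (auto simp: strict_partition_def is_partition_def)
  assume "\<nu> \<in> up \<kappa>"
  then consider i where "i < length \<kappa>" "\<nu> = \<kappa>[i := Suc (\<kappa> ! i)]" | "\<nu> = \<kappa> @ [1]"
    using \<kappa> by (auto simp: up_eq)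
  then show "\<exists>a\<in>up_moves (set \<kappa>). set \<nu> = move_up a (set \<kappa>)"
  proof cases
    case 1
    have "Suc (\<kappa> ! i) \<notin> set \<kappa>"
    proof
      assume "Suc (\<kappa> ! i) \<in> set \<kappa>"
      then obtain j where j: "j < length \<kappa>" "\<kappa> ! j = Suc (\<kappa> ! i)"
        by (auto simp: in_set_conv_nth)
      then have "j \<noteq> i"
        by auto
      then have "\<nu> ! j = \<nu> ! i"
        by (simp add: 1 j(2))
      note j = j \<open>j \<noteq> i\<close> this
      then show False
        using dist(2) 1 j by (metis length_list_update nth_eq_iff_index_eq)
    qed
    then show ?thesis
      using 1 dist by (intro bexI[of _ "\<kappa> ! i"]) (auto simp: up_moves_def move_up_def set_update_distinct)
  next
    case 2
    then show ?thesis
      using dist(2) pos by (intro bexI[of _ 0]) (auto simp: up_moves_def move_up_def)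
  qed
next
  assume "\<exists>a\<in>up_moves (set \<kappa>). set \<nu> = move_up a (set \<kappa>)"
  then obtain a where a: "a \<in> up_moves (set \<kappa>)" "set \<nu> = move_up a (set \<kappa>)" ..
  have sorted: "sorted_wrt (>) \<kappa>" and pos: "0 \<notin> set \<kappa>"
    using \<kappa> by (simp_all add: strict_partition_iff)
  have dist: "distinct \<kappa>"
    using \<kappa> by (simp add: strict_partition_def)
  show "\<nu> \<in> up \<kappa>"
  proof (cases "a = 0")
    case True
    have "1 \<notin> set \<kappa>"
      using a True by (simp add: up_moves_def)
    then have "1 < x" if "x \<in> set \<kappa>" for x
      using that pos by (cases x; cases "x - 1") auto
    then have "strict_partition (\<kappa> @ [1])"
      using sorted pos by (auto simp: strict_partition_iff sorted_wrt_append)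
    moreover from this have "\<nu> = \<kappa> @ [1]"
      using a True pos \<nu> by (intro strict_partition_eqI) (auto simp: move_up_def)
    ultimately show ?thesis
      using \<kappa> by (simp add: up_eq)
  next
    case False
    then obtain i where i: "i < length \<kappa>" "\<kappa> ! i = a" "Suc a \<notin> set \<kappa>"
      using a by (auto simp: up_moves_def in_set_conv_nth)
    \<comment> \<open>Raising \<open>a\<close> keeps the order strict: every earlier part exceeds
      \<open>a\<close> and differs from \<open>a + 1\<close>.\<close>
    have "sorted_wrt (>) (\<kappa>[i := Suc a])"
      unfolding sorted_wrt_iff_nth_less
    proof (intro allI impI)
      fix j k
      assume jk: "j < k" "k < length (\<kappa>[i := Suc a])"
      then have "\<kappa> ! k < \<kappa> ! j" "\<kappa> ! j \<in> set \<kappa>"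
        using sorted by (auto simp: sorted_wrt_iff_nth_less)
      then have "\<kappa> ! k < \<kappa> ! j" "\<kappa> ! j \<noteq> Suc a"
        using i(3) by auto
      then show "\<kappa>[i := Suc a] ! k < \<kappa>[i := Suc a] ! j"
        using jk i by (auto simp: nth_list_update)
    qed
    moreover have set: "set (\<kappa>[i := Suc a]) = move_up a (set \<kappa>)"
      using i dist by (simp add: set_update_distinct move_up_def)
    ultimately have "strict_partition (\<kappa>[i := Suc a])"
      using pos by (auto simp: strict_partition_iff move_up_def)
    moreover from this have "\<nu> = \<kappa>[i := Suc a]"
      using a \<nu> set by (intro strict_partition_eqI) auto
    ultimately show ?thesis
      using \<kappa> i by (auto simp: up_eq)
  qed
qed

lemma mem_down_iff:
  assumes \<kappa>: "strict_partition \<kappa>" and \<nu>: "strict_partition \<nu>"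
  shows "\<kappa> \<in> down \<nu> \<longleftrightarrow> (\<exists>a\<in>down_moves (set \<nu>). set \<kappa> = move_down a (set \<nu>))"
proof -
  have "0 \<notin> set \<kappa>" "0 \<notin> set \<nu>"
    using assms by (auto simp: strict_partition_iff)
  then show ?thesis
    using move_down_move_up[of "set \<kappa>"] move_up_move_down[of "set \<nu>"]
    unfolding down_def using assms by (auto simp: mem_up_iff; metis)
qed

text \<open>The move can be read off its result, \<open>Suc a\<close> being the only element that is
  not a part of \<open>\<kappa>\<close>.\<close>

lemma bij_betw_up:
  assumes "strict_partition \<kappa>"
  shows "bij_betw (\<lambda>a. partition_of (move_up a (set \<kappa>))) (up_moves (set \<kappa>)) (up \<kappa>)"
proof (rule bij_betw_imageI)
  have pos: "0 \<notin> set \<kappa>"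
    using assms by (simp add: strict_partition_iff)
  show "inj_on (\<lambda>a. partition_of (move_up a (set \<kappa>))) (up_moves (set \<kappa>))"
  proof (rule inj_onI)
    fix a b
    assume ab: "a \<in> up_moves (set \<kappa>)" "b \<in> up_moves (set \<kappa>)"
      "partition_of (move_up a (set \<kappa>)) = partition_of (move_up b (set \<kappa>))"
    then have "move_up a (set \<kappa>) = move_up b (set \<kappa>)"
      by (metis List.finite_set finite_moves(3) set_partition_of)
    moreover have "Suc a \<in> move_up a (set \<kappa>)"
      by (simp add: move_up_def)
    ultimately have "Suc a \<in> move_up b (set \<kappa>)"
      by simp
    then show "a = b"
      using ab by (auto simp: move_up_def up_moves_def)
  qed
  show "(\<lambda>a. partition_of (move_up a (set \<kappa>))) ` up_moves (set \<kappa>) = up \<kappa>" (is "?L = _")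
  proof (intro set_eqI iffI)
    fix \<nu>
    assume "\<nu> \<in> ?L"
    then show "\<nu> \<in> up \<kappa>"
      using assms pos by (auto simp: mem_up_iff strict_partition_of move_down_move_up)
  next
    fix \<nu>
    assume \<nu>: "\<nu> \<in> up \<kappa>"
    then obtain a where "a \<in> up_moves (set \<kappa>)" "set \<nu> = move_up a (set \<kappa>)"
      using assms mem_up_iff up_strict by blast
    then show "\<nu> \<in> ?L"
      using partition_of_set[OF up_strict[OF \<nu>]] by auto
  qed
qed

lemma finite_up:
  assumes "strict_partition \<kappa>"
  shows "finite (up \<kappa>)"
  using bij_betw_finite[OF bij_betw_up[OF assms]] by simp

lemma sum_up:
  assumes "strict_partition \<kappa>"
  shows "(\<Sum>\<nu>\<in>up \<kappa>. f \<nu>) = (\<Sum>a\<in>up_moves (set \<kappa>). f (partition_of (move_up a (set \<kappa>))))"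
  by (rule sum.reindex_bij_betw[OF bij_betw_up[OF assms], symmetric])

lemma bij_betw_down:
  assumes "strict_partition \<nu>"
  shows "bij_betw (\<lambda>a. partition_of (move_down a (set \<nu>))) (down_moves (set \<nu>)) (down \<nu>)"
proof (rule bij_betw_imageI)
  have pos: "0 \<notin> set \<nu>"
    using assms by (simp add: strict_partition_iff)
  show "inj_on (\<lambda>a. partition_of (move_down a (set \<nu>))) (down_moves (set \<nu>))"
  proof (rule inj_onI)
    fix a b
    assume ab: "a \<in> down_moves (set \<nu>)" "b \<in> down_moves (set \<nu>)"
      "partition_of (move_down a (set \<nu>)) = partition_of (move_down b (set \<nu>))"
    then have "move_down a (set \<nu>) = move_down b (set \<nu>)"
      by (metis List.finite_set finite_moves(4) set_partition_of)
    moreover have "Suc a \<notin> move_down a (set \<nu>)"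
      by (simp add: move_down_def)
    ultimately have "Suc a \<notin> move_down b (set \<nu>)"
      by simp
    then show "a = b"
      using ab by (auto simp: move_down_def down_moves_def)
  qed
  show "(\<lambda>a. partition_of (move_down a (set \<nu>))) ` down_moves (set \<nu>) = down \<nu>" (is "?L = _")
  proof (intro set_eqI iffI)
    fix \<kappa>
    assume "\<kappa> \<in> ?L"
    then show "\<kappa> \<in> down \<nu>"
      using assms pos by (auto simp: mem_down_iff strict_partition_of move_up_move_down)
  next
    fix \<kappa>
    assume \<kappa>: "\<kappa> \<in> down \<nu>"
    then obtain a where "a \<in> down_moves (set \<nu>)" "set \<kappa> = move_down a (set \<nu>)"
      using assms mem_down_iff down_strict by blast
    then show "\<kappa> \<in> ?L"
      using partition_of_set[OF down_strict[OF \<kappa>]] by auto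
  qed
qed

lemma finite_down:
  assumes "strict_partition \<nu>"
  shows "finite (down \<nu>)"
  using bij_betw_finite[OF bij_betw_down[OF assms]] by simp

lemma sum_down:
  assumes "strict_partition \<nu>"
  shows "(\<Sum>\<kappa>\<in>down \<nu>. f \<kappa>) = (\<Sum>a\<in>down_moves (set \<nu>). f (partition_of (move_down a (set \<nu>))))"
  by (rule sum.reindex_bij_betw[OF bij_betw_down[OF assms], symmetric])

section \<open>Weights, commutation and chains\<close>

text \<open>For a cover this is 1 if the new box opens a row and 2 otherwise; the exponents add up
  along a chain to the exponent in \<open>expect\<close>.\<close>

definition weight :: "nat list \<Rightarrow> nat list \<Rightarrow> rat" where
  "weight \<kappa> \<nu> = 2 powi (1 - int (length \<nu>) + int (length \<kappa>))"

lemma strict_partition_length: "strict_partition lam \<Longrightarrow> length lam = card (set lam)"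
  by (simp add: strict_partition_def distinct_card)

lemma weight_move_down:
  assumes \<nu>: "strict_partition \<nu>" and b: "b \<in> down_moves (set \<nu>)"
  shows "weight (partition_of (move_down b (set \<nu>))) \<nu> = (if b = 0 then 1 else 2)"
proof -
  have "length (partition_of (move_down b (set \<nu>))) = card (move_down b (set \<nu>))"
    by (simp add: partition_of_def)
  moreover have "card (move_down 0 (set \<nu>)) = card (set \<nu>) - 1" "card (set \<nu>) > 0" if "b = 0"
    using b that by (auto simp: move_down_def down_moves_def card_gt_0_iff)
  moreover have "card (move_down b (set \<nu>)) = card (set \<nu>)" if "b \<noteq> 0"
  proof -
    have "move_down b (set \<nu>) = insert b (set \<nu> - {Suc b})"
      using that by (auto simp: move_down_def)
    then show ?thesis
      using b card_Suc_Diff1[of "set \<nu>" "Suc b"] by (simp add: down_moves_def)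
  qed
  ultimately show ?thesis
    using strict_partition_length[OF \<nu>] by (cases "b = 0") (auto simp: weight_def of_nat_diff)
qed

text \<open>Telescoping: with g(0) = 1 and, for a > 0, g(a) = 2 or 0 according to whether a is a
  part, the up weight minus the down weight at a is g(a) - g(a+1), and g vanishes beyond the largest
  part.\<close>

lemma sum_moves_weight:
  assumes "finite A" "0 \<notin> A"
  shows "(\<Sum>a\<in>up_moves A. if a = 0 then 1 else 2) = 1 + (\<Sum>b\<in>down_moves A. if b = 0 then 1 else (2::rat))"
proof -
  obtain K where K: "\<And>a. a \<in> A \<Longrightarrow> a < K"
    using finite_nat_set_iff_bounded[of A] assms(1) by blast
  let ?g = "\<lambda>a. if a = 0 then 1 else 2 * of_bool (a \<in> A) :: rat"
  let ?u = "\<lambda>a. if a \<in> up_moves A then (if a = 0 then 1 else 2) else (0::rat)"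
  let ?d = "\<lambda>a. if a \<in> down_moves A then (if a = 0 then 1 else 2) else (0::rat)"
  have sub: "up_moves A \<subseteq> {..<Suc K}" "down_moves A \<subseteq> {..<Suc K}"
    using K by (force simp: up_moves_def down_moves_def)+
  have "(\<Sum>a\<in>up_moves A. if a = 0 then 1 else 2) - (\<Sum>b\<in>down_moves A. if b = 0 then 1 else (2::rat)) =
      (\<Sum>a<Suc K. ?u a) - (\<Sum>a<Suc K. ?d a)"
    using sub by (simp only: sum.inter_restrict[symmetric] finite_lessThan Int_absorb1)
  also have "\<dots> = (\<Sum>a<Suc K. ?g a - ?g (Suc a))"
    unfolding sum_subtractf[symmetric] using assms(2)
    by (intro sum.cong refl) (auto simp: up_moves_def down_moves_def)
  also have "\<dots> = ?g 0 - ?g (Suc K)"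
    by (rule sum_lessThan_telescope')
  also have "\<dots> = 1"
    using K[of "Suc K"] by auto
  finally show ?thesis by simp
qed

text \<open>The relation \<open>D U = 1 + U D\<close>: the moves \<open>a\<close> up and \<open>b\<close> down commute for \<open>a \<noteq> b\<close>, and the terms
  with \<open>a = b\<close> are compared by the previous lemma.\<close>

lemma sum_moves_commute:
  fixes h :: "nat set \<Rightarrow> rat"
  assumes "finite A" "0 \<notin> A"
  defines "wt \<equiv> \<lambda>b::nat. if b = 0 then 1 else (2::rat)"
  shows "(\<Sum>a\<in>up_moves A. \<Sum>b\<in>down_moves (move_up a A). wt b * h (move_down b (move_up a A))) =
    h A + (\<Sum>b\<in>down_moves A. wt b * (\<Sum>a\<in>up_moves (move_down b A). h (move_up a (move_down b A))))"
proof -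
  \<comment> \<open>The interfering pairs are excluded. For a = b + 1 both moves act on the part
    \<open>a\<close>; for b = a + 1 the move \<open>a\<close> up fills the place to which
    \<open>b\<close> would move down. Apart from these, the only down move created by moving
    \<open>a\<close> up is its inverse.\<close>
  let ?R = "\<lambda>a b. a \<noteq> Suc b \<and> b \<noteq> Suc a"
  have fin: "finite (up_moves A)" "finite (down_moves A)"
    using assms(1) by simp_all
  have down: "down_moves (move_up a A) = insert a {b \<in> down_moves A. ?R a b}" "a \<notin> {b \<in> down_moves A. ?R a b}"
    if "a \<in> up_moves A" for a
    using that assms(2) by (auto simp: up_moves_def down_moves_def move_up_def)
  have up: "up_moves (move_down b A) = insert b {a \<in> up_moves A. ?R a b}" "b \<notin> {a \<in> up_moves A. ?R a b}"
    if "b \<in> down_moves A" for b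
    using that assms(2) by (auto simp: up_moves_def down_moves_def move_down_def)
  have comm: "move_down b (move_up a A) = move_up a (move_down b A)"
    if "a \<in> up_moves A" "b \<in> down_moves A" "?R a b" for a b
    using that assms(2) by (auto simp: up_moves_def down_moves_def move_down_def move_up_def)
  let ?S = "\<Sum>a\<in>up_moves A. \<Sum>b | b \<in> down_moves A \<and> ?R a b. wt b * h (move_down b (move_up a A))"
  have "(\<Sum>a\<in>up_moves A. \<Sum>b\<in>down_moves (move_up a A). wt b * h (move_down b (move_up a A))) =
      (\<Sum>a\<in>up_moves A. wt a * h A + (\<Sum>b | b \<in> down_moves A \<and> ?R a b. wt b * h (move_down b (move_up a A))))"
  proof (intro sum.cong refl)
    fix a
    assume a: "a \<in> up_moves A"
    have "finite {b \<in> down_moves A. ?R a b}"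
      using fin by simp
    then show "(\<Sum>b\<in>down_moves (move_up a A). wt b * h (move_down b (move_up a A))) =
        wt a * h A + (\<Sum>b | b \<in> down_moves A \<and> ?R a b. wt b * h (move_down b (move_up a A)))"
      unfolding down(1)[OF a] using down(2)[OF a]
      by (subst sum.insert) (assumption, assumption, simp only: move_down_move_up(2)[OF assms(2) a])
  qed
  also have "\<dots> = (\<Sum>a\<in>up_moves A. wt a) * h A + ?S"
    by (simp only: sum.distrib sum_distrib_right)
  also have "?S = (\<Sum>b\<in>down_moves A. \<Sum>a | a \<in> up_moves A \<and> ?R a b. wt b * h (move_down b (move_up a A)))"
    using fin by (rule sum.swap_restrict)
  also have "(\<Sum>a\<in>up_moves A. wt a) * h A = h A + (\<Sum>b\<in>down_moves A. wt b * h A)"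
    unfolding wt_def sum_moves_weight[OF assms(1,2)] by (simp add: distrib_right sum_distrib_right)
  also have "h A + (\<Sum>b\<in>down_moves A. wt b * h A) +
        (\<Sum>b\<in>down_moves A. \<Sum>a | a \<in> up_moves A \<and> ?R a b. wt b * h (move_down b (move_up a A))) =
      h A + (\<Sum>b\<in>down_moves A. wt b * h A + (\<Sum>a | a \<in> up_moves A \<and> ?R a b. wt b * h (move_down b (move_up a A))))"
    by (simp only: sum.distrib add.assoc)
  also have "(\<Sum>b\<in>down_moves A. wt b * h A + (\<Sum>a | a \<in> up_moves A \<and> ?R a b. wt b * h (move_down b (move_up a A)))) =
      (\<Sum>b\<in>down_moves A. wt b * (\<Sum>a\<in>up_moves (move_down b A). h (move_up a (move_down b A))))"
  proof (intro sum.cong refl)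
    fix b
    assume b: "b \<in> down_moves A"
    have "(\<Sum>a\<in>up_moves (move_down b A). h (move_up a (move_down b A))) =
        h A + (\<Sum>a | a \<in> up_moves A \<and> ?R a b. h (move_up a (move_down b A)))"
      using fin up(2)[OF b] by (simp add: up(1)[OF b] move_up_move_down(2)[OF assms(2) b])
    also have "(\<Sum>a | a \<in> up_moves A \<and> ?R a b. h (move_up a (move_down b A))) =
        (\<Sum>a | a \<in> up_moves A \<and> ?R a b. h (move_down b (move_up a A)))"
      using b by (intro sum.cong refl) (simp add: comm)
    finally show "wt b * h A + (\<Sum>a | a \<in> up_moves A \<and> ?R a b. wt b * h (move_down b (move_up a A))) =
        wt b * (\<Sum>a\<in>up_moves (move_down b A). h (move_up a (move_down b A)))"
      by (simp add: distrib_left sum_distrib_left)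
  qed
  finally show ?thesis .
qed

lemma sum_up_down_commute:
  fixes h :: "nat list \<Rightarrow> rat"
  assumes "strict_partition \<nu>"
  shows "(\<Sum>\<nu>'\<in>up \<nu>. \<Sum>\<kappa>\<in>down \<nu>'. weight \<kappa> \<nu>' * h \<kappa>) =
    h \<nu> + (\<Sum>\<kappa>\<in>down \<nu>. weight \<kappa> \<nu> * (\<Sum>\<nu>'\<in>up \<kappa>. h \<nu>'))"
proof -
  let ?A = "set \<nu>" and ?wt = "\<lambda>b::nat. if b = 0 then 1 else (2::rat)" and ?h = "\<lambda>A. h (partition_of A)"
  have A: "finite ?A" "0 \<notin> ?A"
    using assms by (auto simp: strict_partition_iff)
  have inner: "(\<Sum>\<kappa>\<in>down \<nu>'. weight \<kappa> \<nu>' * f \<kappa>) =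
      (\<Sum>b\<in>down_moves (set \<nu>'). ?wt b * f (partition_of (move_down b (set \<nu>'))))"
    if "strict_partition \<nu>'" for \<nu>' f
    by (simp only: sum_down[OF that]) (rule sum.cong[OF refl], simp only: weight_move_down[OF that])
  have up: "strict_partition (partition_of (move_up a ?A))" "set (partition_of (move_up a ?A)) = move_up a ?A"
    if "a \<in> up_moves ?A" for a
    using that A by (simp_all add: strict_partition_of move_down_move_up(3))
  have down: "strict_partition (partition_of (move_down a ?A))" "set (partition_of (move_down a ?A)) = move_down a ?A"
    if "a \<in> down_moves ?A" for a
    using that A by (simp_all add: strict_partition_of move_up_move_down(3))
  have "(\<Sum>\<nu>'\<in>up \<nu>. \<Sum>\<kappa>\<in>down \<nu>'. weight \<kappa> \<nu>' * h \<kappa>) =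
      (\<Sum>a\<in>up_moves ?A. \<Sum>b\<in>down_moves (move_up a ?A). ?wt b * ?h (move_down b (move_up a ?A)))"
    unfolding sum_up[OF assms] by (intro sum.cong refl) (simp only: inner up)
  also have "\<dots> = ?h ?A + (\<Sum>b\<in>down_moves ?A. ?wt b * (\<Sum>a\<in>up_moves (move_down b ?A). ?h (move_up a (move_down b ?A))))"
    by (rule sum_moves_commute[OF A])
  also have "\<dots> = h \<nu> + (\<Sum>\<kappa>\<in>down \<nu>. weight \<kappa> \<nu> * (\<Sum>\<nu>'\<in>up \<kappa>. h \<nu>'))"
    unfolding inner[OF assms] partition_of_set[OF assms]
    by (intro arg_cong2[where f = "(+)"] sum.cong refl) (simp only: sum_up down)
  finally show ?thesis .
qed

section \<open>Counting chains by their first step\<close>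

lemma shifted_chains_subset:
  assumes "c \<in> shifted_chains lam \<mu>"
  shows "shifted_diagram \<mu> \<subseteq> shifted_diagram lam"
proof -
  have c: "c \<noteq> []" "hd c = \<mu>" "last c = lam"
      and step: "\<And>i. Suc i < length c \<Longrightarrow> adds_one_box (c ! i) (c ! Suc i)"
    using assms by (auto simp: shifted_chains_def)
  have "i < length c \<Longrightarrow> shifted_diagram (c ! 0) \<subseteq> shifted_diagram (c ! i)" for i
  proof (induction i)
    case (Suc i)
    then show ?case
      using step[of i] by (auto simp: adds_one_box_def)
  qed simp
  from this[of "length c - 1"] show ?thesis
    using c by (simp add: hd_conv_nth last_conv_nth)
qed

text \<open>Diagrams grow along a chain, so if the inclusion fails there is no chain to
  count.\<close>

lemma g_skew_eq_card: "g_skew lam \<mu> = card (shifted_chains lam \<mu>)"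
proof (cases "shifted_chains lam \<mu> = {}")
  case False
  then have "shifted_diagram \<mu> \<subseteq> shifted_diagram lam"
    using shifted_chains_subset by blast
  then show ?thesis by (simp add: g_skew_def)
qed (simp add: g_skew_def)

text \<open>The truncated difference of the sizes is 0 here, so a chain has a single entry.\<close>

lemma shifted_chains_base:
  assumes "sum_list lam \<le> sum_list \<mu>" "strict_partition lam"
  shows "shifted_chains lam \<mu> = (if lam = \<mu> then {[lam]} else {})"
  using assms by (auto simp: shifted_chains_def length_Suc_conv)

lemma shifted_chains_step:
  assumes \<mu>: "strict_partition \<mu>" and less: "sum_list \<mu> < sum_list lam"
  shows "shifted_chains lam \<mu> = (\<Union>\<nu>\<in>up \<mu>. (#) \<mu> ` shifted_chains lam \<nu>)"
proof (intro set_eqI iffI)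
  fix c
  assume c: "c \<in> shifted_chains lam \<mu>"
  then have "length c = Suc (Suc (sum_list lam - Suc (sum_list \<mu>)))"
    using less by (simp add: shifted_chains_def Suc_diff_Suc)
  then obtain \<nu> d where d: "c = \<mu> # \<nu> # d" "length d = sum_list lam - Suc (sum_list \<mu>)"
    using c by (auto simp: length_Suc_conv shifted_chains_def)
  have step: "\<And>i. Suc i < length c \<Longrightarrow> adds_one_box (c ! i) (c ! Suc i)"
    using c by (auto simp: shifted_chains_def)
  have "adds_one_box \<mu> \<nu>"
    using step[of 0] by (simp add: d(1))
  then have \<nu>: "\<nu> \<in> up \<mu>"
    using c by (simp add: d(1) up_def shifted_chains_def)
  have "adds_one_box ((\<nu> # d) ! i) ((\<nu> # d) ! Suc i)" if "Suc i < length (\<nu> # d)" for i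
    using step[of "Suc i"] that by (simp add: d(1))
  then have "\<nu> # d \<in> shifted_chains lam \<nu>"
    using c d(2) sum_list_up[OF \<mu> \<nu>] by (auto simp: d(1) shifted_chains_def)
  then show "c \<in> (\<Union>\<nu>\<in>up \<mu>. (#) \<mu> ` shifted_chains lam \<nu>)"
    using \<nu> d(1) by blast
next
  fix c
  assume "c \<in> (\<Union>\<nu>\<in>up \<mu>. (#) \<mu> ` shifted_chains lam \<nu>)"
  then obtain \<nu> d where \<nu>: "\<nu> \<in> up \<mu>" and d: "d \<in> shifted_chains lam \<nu>" and c: "c = \<mu> # d"
    by blast
  have "adds_one_box (c ! i) (c ! Suc i)" if "Suc i < length c" for i
  proof (cases i)
    case 0
    have "d \<noteq> []" "hd d = \<nu>"
      using d by (auto simp: shifted_chains_def)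
    then show ?thesis
      using 0 \<nu> by (simp add: c up_def hd_conv_nth)
  next
    case (Suc j)
    then show ?thesis
      using that d by (simp add: c shifted_chains_def)
  qed
  moreover have "length c = Suc (sum_list lam - sum_list \<mu>)"
    using d less sum_list_up[OF \<mu> \<nu>] by (simp add: c shifted_chains_def)
  ultimately show "c \<in> shifted_chains lam \<mu>"
    using d \<mu> by (auto simp: c shifted_chains_def)
qed

lemma finite_shifted_chains:
  assumes "strict_partition lam" "strict_partition \<mu>"
  shows "finite (shifted_chains lam \<mu>)"
  using assms(2)
proof (induction "sum_list lam - sum_list \<mu>" arbitrary: \<mu>)
  case 0
  then show ?case
    using assms(1) by (simp add: shifted_chains_base)
next
  case (Suc n)
  then show ?case
    using sum_list_up[OF Suc.prems]
    by (auto simp: shifted_chains_step finite_up intro!: Suc.hyps(1) up_strict)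
qed

lemma g_skew_base:
  assumes "sum_list lam \<le> sum_list \<mu>" "strict_partition lam"
  shows "g_skew lam \<mu> = of_bool (lam = \<mu>)"
  using assms by (simp add: g_skew_eq_card shifted_chains_base)

lemma g_skew_step:
  assumes "strict_partition lam" "strict_partition \<mu>" "sum_list \<mu> < sum_list lam"
  shows "g_skew lam \<mu> = (\<Sum>\<nu>\<in>up \<mu>. g_skew lam \<nu>)"
proof -
  have hd: "hd c = \<nu>" if "c \<in> shifted_chains lam \<nu>" for c \<nu>
    using that by (simp add: shifted_chains_def)
  have "card (\<Union>\<nu>\<in>up \<mu>. (#) \<mu> ` shifted_chains lam \<nu>) = (\<Sum>\<nu>\<in>up \<mu>. card ((#) \<mu> ` shifted_chains lam \<nu>))"
  proof (rule card_UN_disjoint)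
    show "\<forall>\<nu>\<in>up \<mu>. finite ((#) \<mu> ` shifted_chains lam \<nu>)"
      using assms(1) up_strict by (auto intro: finite_shifted_chains)
    show "\<forall>\<nu>\<in>up \<mu>. \<forall>\<nu>'\<in>up \<mu>. \<nu> \<noteq> \<nu>' \<longrightarrow>
        (#) \<mu> ` shifted_chains lam \<nu> \<inter> (#) \<mu> ` shifted_chains lam \<nu>' = {}"
      using hd by blast
  qed (use assms in \<open>simp add: finite_up\<close>)
  also have "\<dots> = (\<Sum>\<nu>\<in>up \<mu>. card (shifted_chains lam \<nu>))"
    by (simp add: card_image)
  finally show ?thesis
    using assms by (simp add: g_skew_eq_card shifted_chains_step)
qed

lemma finite_SP [simp]: "finite (SP k)"
proof (rule finite_subset)
  show "finite {xs. set xs \<subseteq> {..k} \<and> length xs \<le> k}"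
    by (rule finite_lists_length_le) simp
  have "length xs \<le> sum_list xs" if "0 \<notin> set xs" for xs :: "nat list"
    using that by (induction xs) auto
  then show "SP k \<subseteq> {xs. set xs \<subseteq> {..k} \<and> length xs \<le> k}"
    by (auto simp: SP_def strict_partition_iff elem_le_sum_list in_set_conv_nth)
qed

section \<open>Harmonicity\<close>

text \<open>The raised or appended part can only violate strictness against its left neighbour, and
  then the two are equal; these are the terms killed by \<open>sym_sum_adjacent_eq\<close>.\<close>

lemma non_strict_candidate:
  assumes \<kappa>: "strict_partition \<kappa>"
    and \<nu>: "\<nu> \<in> (\<lambda>i. \<kappa>[i := Suc (\<kappa> ! i)]) ` {..<length \<kappa>} \<union> {\<kappa> @ [1]}" "\<not> strict_partition \<nu>"
  shows "\<exists>as a bs. \<nu> = as @ a # a # bs"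
proof -
  have sorted: "sorted_wrt (>) \<kappa>" and pos: "0 \<notin> set \<kappa>"
    using \<kappa> by (simp_all add: strict_partition_iff)
  \<comment> \<open>The last entry of \<open>xs\<close> is its least, so it is squeezed between
    \<open>a\<close> and \<open>a + 1\<close>.\<close>
  have part: "\<exists>xs'. xs = xs' @ [Suc a]" if xs: "sorted_wrt (>) xs" "\<forall>x\<in>set xs. a < x" "\<exists>x\<in>set xs. x \<le> Suc a" for xs a
  proof -
    obtain x where x: "x \<in> set xs" "x \<le> Suc a"
      using xs(3) by blast
    then obtain xs' l where l: "xs = xs' @ [l]"
      by (metis rev_exhaust empty_iff empty_set)
    have "l \<le> x"
      using xs(1) x(1) l by (auto simp: sorted_wrt_append intro: less_imp_le)
    then have "l = Suc a"
      using xs(2) x l by fastforce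
    then show ?thesis
      using l by blast
  qed
  from \<nu>(1) consider i where "i < length \<kappa>" "\<nu> = \<kappa>[i := Suc (\<kappa> ! i)]" | "\<nu> = \<kappa> @ [1]"
    by auto
  then show ?thesis
  proof cases
    case 1
    define xs a ys where "xs = take i \<kappa>" and "a = \<kappa> ! i" and "ys = drop (Suc i) \<kappa>"
    have dec: "\<kappa> = xs @ a # ys" "\<nu> = xs @ Suc a # ys"
      using 1 by (simp_all add: xs_def a_def ys_def id_take_nth_drop upd_conv_take_nth_drop)
    have "sorted_wrt (>) xs" "\<forall>x\<in>set xs. a < x"
      using sorted by (auto simp: dec(1) sorted_wrt_append)
    moreover have "\<exists>x\<in>set xs. x \<le> Suc a"
    proof (rule ccontr)
      assume "\<not> (\<exists>x\<in>set xs. x \<le> Suc a)"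
      then have "sorted_wrt (>) \<nu>" "0 \<notin> set \<nu>"
        using sorted pos by (force simp: dec sorted_wrt_append)+
      then show False
        using \<nu>(2) by (simp add: strict_partition_iff)
    qed
    ultimately obtain xs' where "xs = xs' @ [Suc a]"
      using part by blast
    then have "\<nu> = xs' @ Suc a # Suc a # ys"
      by (simp add: dec(2))
    then show ?thesis by blast
  next
    case 2
    have "\<exists>x\<in>set \<kappa>. x \<le> Suc 0"
    proof (rule ccontr)
      assume "\<not> (\<exists>x\<in>set \<kappa>. x \<le> Suc 0)"
      then have "sorted_wrt (>) \<nu>" "0 \<notin> set \<nu>"
        using sorted pos by (force simp: 2 sorted_wrt_append)+
      then show False
        using \<nu>(2) by (simp add: strict_partition_iff)
    qed
    moreover have "\<forall>x\<in>set \<kappa>. 0 < x"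
      using pos by (metis gr0I)
    ultimately obtain xs' where "\<kappa> = xs' @ [Suc 0]"
      using part sorted by blast
    then have "\<nu> = xs' @ 1 # 1 # []"
      by (simp add: 2)
    then show ?thesis by blast
  qed
qed

text \<open>The candidates in \<open>sym_sum_pieri\<close> are pairwise different, and those outside
  \<open>up \<kappa>\<close> contribute 0, so the sum over positions becomes a sum over
  covers.\<close>

lemma sym_sum_pieri_strict:
  assumes pw: "\<And>x. pw x 0 = 1" "\<And>x k. pw x (Suc k) = (x - c * of_nat k) * pw x k"
    and X: "finite X" and \<kappa>: "strict_partition \<kappa>"
  shows "(\<Sum>X - c * of_nat (sum_list \<kappa>)) * sym_sum pw \<kappa> X = (\<Sum>\<nu>\<in>up \<kappa>. sym_sum pw \<nu> X)"
proof -
  let ?u = "\<lambda>i. \<kappa>[i := Suc (\<kappa> ! i)]"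
  let ?I = "?u ` {..<length \<kappa>}"
  have inj: "inj_on ?u {..<length \<kappa>}"
  proof (rule inj_onI, rule ccontr)
    fix i j
    assume *: "i \<in> {..<length \<kappa>}" "?u i = ?u j" "i \<noteq> j"
    have "?u i ! i = ?u j ! i"
      by (simp only: *(2))
    moreover have "?u i ! i = Suc (\<kappa> ! i)" "?u j ! i = \<kappa> ! i"
      using *(1,3) by simp_all
    ultimately show False
      by simp
  qed
  have notin: "\<kappa> @ [1] \<notin> ?I"
  proof
    assume "\<kappa> @ [1] \<in> ?I"
    then have "length (\<kappa> @ [1]) = length \<kappa>"
      by (metis (no_types, lifting) imageE length_list_update)
    then show False by simp
  qed
  have "(\<Sum>X - c * of_nat (sum_list \<kappa>)) * sym_sum pw \<kappa> X = (\<Sum>\<nu>\<in>?I. sym_sum pw \<nu> X) + sym_sum pw (\<kappa> @ [1]) X"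
    using sym_sum_pieri[OF pw X, of \<kappa>] by (simp add: sum.reindex[OF inj])
  also have "\<dots> = (\<Sum>\<nu>\<in>?I \<union> {\<kappa> @ [1]}. sym_sum pw \<nu> X)"
    using notin by simp
  also have "\<dots> = (\<Sum>\<nu>\<in>up \<kappa>. sym_sum pw \<nu> X)"
  proof (rule sum.mono_neutral_right)
    show "\<forall>\<nu>\<in>(?I \<union> {\<kappa> @ [1]}) - up \<kappa>. sym_sum pw \<nu> X = 0"
    proof
      fix \<nu>
      assume "\<nu> \<in> (?I \<union> {\<kappa> @ [1]}) - up \<kappa>"
      then obtain as a bs where "\<nu> = as @ a # a # bs"
        using non_strict_candidate[OF \<kappa>, of \<nu>] by (auto simp: up_eq[OF \<kappa>])
      then show "sym_sum pw \<nu> X = 0"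
        using sym_sum_adjacent_eq[OF X] by simp
    qed
  qed (auto simp: up_eq[OF \<kappa>])
  finally show ?thesis .
qed

section \<open>The values P*_\<nu>(\<lambda>) of the factorial functions at strict
  partitions\<close>

definition falling_value :: "nat list \<Rightarrow> nat list \<Rightarrow> rat" where
  "falling_value \<nu> lam = sym_sum falling \<nu> (of_nat ` set lam)"

lemma falling_value_pieri:
  assumes "strict_partition \<nu>" "strict_partition lam"
  shows "(of_nat (sum_list lam) - of_nat (sum_list \<nu>)) * falling_value \<nu> lam =
    (\<Sum>\<nu>'\<in>up \<nu>. falling_value \<nu>' lam)"
proof -
  have "\<Sum>(of_nat ` set lam :: rat set) = of_nat (sum_list lam)"
    using assms(2) by (simp add: sum.reindex strict_partition_def distinct_sum_list_conv_Sum)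
  then show ?thesis
    using sym_sum_pieri_strict[of falling 1 "of_nat ` set lam" \<nu>] assms(1)
    by (simp add: falling_value_def falling_Suc)
qed

lemma partition_dominated:
  fixes \<nu> lam :: "nat list"
  assumes "length \<nu> \<le> length lam" "\<And>i. i < length \<nu> \<Longrightarrow> \<nu> ! i \<le> lam ! i" "0 \<notin> set lam"
  shows "sum_list \<nu> \<le> sum_list lam \<and> (sum_list \<nu> = sum_list lam \<longrightarrow> \<nu> = lam)"
  using assms
proof (induction \<nu> arbitrary: lam)
  case Nil
  then show ?case by (cases lam) auto
next
  case (Cons a \<nu>)
  then obtain b lam' where lam: "lam = b # lam'"
    by (cases lam) auto
  have "sum_list \<nu> \<le> sum_list lam' \<and> (sum_list \<nu> = sum_list lam' \<longrightarrow> \<nu> = lam')"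
    using Cons.prems Cons.prems(2)[of "Suc _"] by (intro Cons.IH) (auto simp: lam)
  moreover have "a \<le> b"
    using Cons.prems(2)[of 0] by (simp add: lam)
  ultimately show ?case
    by (auto simp: lam)
qed

text \<open>By size, \<open>\<nu>\<close> cannot be contained in \<open>lam\<close>, so some row
  \<open>i\<close> of \<open>\<nu>\<close> is longer than that of \<open>lam\<close>. Then only the
  first \<open>i\<close> parts of \<open>lam\<close> can reach \<open>\<nu> ! i\<close>, too few for
  a nonzero term.\<close>

lemma falling_value_eq_0:
  assumes \<nu>: "strict_partition \<nu>" and lam: "strict_partition lam"
    and "sum_list lam \<le> sum_list \<nu>" "lam \<noteq> \<nu>"
  shows "falling_value \<nu> lam = 0"
proof -
  have "\<exists>i<length \<nu>. length lam \<le> i \<or> lam ! i < \<nu> ! i"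
  proof (rule ccontr)
    assume *: "\<not> (\<exists>i<length \<nu>. length lam \<le> i \<or> lam ! i < \<nu> ! i)"
    then have "length \<nu> \<le> length lam"
      by (meson linorder_not_le order_refl)
    moreover have "\<nu> ! i \<le> lam ! i" if "i < length \<nu>" for i
      using * that not_less by blast
    moreover have "0 \<notin> set lam"
      using lam by (simp add: strict_partition_iff)
    ultimately have "sum_list \<nu> \<le> sum_list lam \<and> (sum_list \<nu> = sum_list lam \<longrightarrow> \<nu> = lam)"
      by (rule partition_dominated)
    then show False
      using assms(3,4) by auto
  qed
  then obtain i where i: "i < length \<nu>" "length lam \<le> i \<or> lam ! i < \<nu> ! i"
    by blast
  have "{x \<in> set lam. \<nu> ! i \<le> x} \<subseteq> (!) lam ` {..<i}"
  proof
    fix x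
    assume "x \<in> {x \<in> set lam. \<nu> ! i \<le> x}"
    then obtain j where j: "j < length lam" "x = lam ! j" "\<nu> ! i \<le> lam ! j"
      by (auto simp: in_set_conv_nth)
    have "j < i"
    proof (rule ccontr)
      assume "\<not> j < i"
      then have "lam ! j \<le> lam ! i" "i < length lam"
        using lam j(1) by (auto simp: strict_partition_iff sorted_wrt_iff_nth_less le_less not_less)
      then show False
        using i(2) j(3) by simp
    qed
    then show "x \<in> (!) lam ` {..<i}"
      using j(2) by blast
  qed
  then have "card {x \<in> set lam. \<nu> ! i \<le> x} \<le> card ((!) lam ` {..<i})"
    by (intro card_mono) auto
  also have "\<dots> \<le> i"
    using card_image_le[of "{..<i}"] by simp
  finally show ?thesis
    unfolding falling_value_def using \<nu> i(1)
    by (intro sym_sum_falling_eq_0[of _ _ i]) (auto simp: strict_partition_def is_partition_def)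
qed

text \<open>Induction on the difference of sizes. Both sides satisfy a recursion over
  \<open>up \<nu>\<close>: the left by the first step of a chain, the right by the Pieri rule, whose
  factor builds up the factorial. Vanishing settles equal sizes.\<close>

lemma g_skew_falling_value:
  assumes \<nu>: "strict_partition \<nu>" and lam: "strict_partition lam"
    and "sum_list \<nu> \<le> sum_list lam"
  shows "of_nat (g_skew lam \<nu>) * falling_value lam lam = fact (sum_list lam - sum_list \<nu>) * falling_value \<nu> lam"
  using \<nu> assms(3)
proof (induction "sum_list lam - sum_list \<nu>" arbitrary: \<nu>)
  case 0
  then show ?case
    using falling_value_eq_0[OF 0(2) lam] lam by (auto simp: g_skew_base)
next
  case (Suc n)
  then have less: "sum_list \<nu> < sum_list lam"
    by simp
  have "of_nat (g_skew lam \<nu>) * falling_value lam lam = (\<Sum>\<nu>'\<in>up \<nu>. of_nat (g_skew lam \<nu>') * falling_value lam lam)"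
    using g_skew_step[OF lam Suc.prems(1) less] by (simp add: sum_distrib_right)
  also have "\<dots> = (\<Sum>\<nu>'\<in>up \<nu>. fact n * falling_value \<nu>' lam)"
  proof (intro sum.cong refl)
    fix \<nu>'
    assume \<nu>': "\<nu>' \<in> up \<nu>"
    then have "sum_list \<nu>' = Suc (sum_list \<nu>)"
      using sum_list_up Suc.prems(1) by blast
    then have "n = sum_list lam - sum_list \<nu>'" "sum_list \<nu>' \<le> sum_list lam"
      using Suc.hyps(2) less by auto
    then show "of_nat (g_skew lam \<nu>') * falling_value lam lam = fact n * falling_value \<nu>' lam"
      using Suc.hyps(1)[of \<nu>'] up_strict[OF \<nu>'] by simp
  qed
  also have "\<dots> = fact n * ((of_nat (sum_list lam) - of_nat (sum_list \<nu>)) * falling_value \<nu> lam)"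
    using falling_value_pieri[OF Suc.prems(1) lam] by (simp add: sum_distrib_left)
  also have "of_nat (sum_list lam) - of_nat (sum_list \<nu>) = (of_nat (Suc n) :: rat)"
    unfolding Suc.hyps(2) using less by (simp add: of_nat_diff)
  finally show ?case
    by (simp add: Suc.hyps(2)[symmetric] algebra_simps)
qed

lemma strict_partition_Nil [simp]: "strict_partition []"
  by (simp add: strict_partition_iff)

lemma g_num_falling_value:
  assumes "strict_partition lam"
  shows "of_nat (g_num lam) * falling_value lam lam = fact (sum_list lam)"
  using g_skew_falling_value[OF strict_partition_Nil assms] by (simp add: g_num_def falling_value_def)

text \<open>Existence of a chain is read off the formula for \<open>g_num\<close>, whose right-hand
  side is a factorial; no chain has to be constructed.\<close>

lemma g_num_nonzero:
  assumes "strict_partition lam"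
  shows "g_num lam \<noteq> 0"
  using g_num_falling_value[OF assms] by (metis fact_nonzero mult_zero_left of_nat_0)

definition plancherel_density :: "nat list \<Rightarrow> rat" where
  "plancherel_density lam = of_nat (g_num lam) / fact (sum_list lam)"

text \<open>This quantity is \<open>g\<^bsup>\<lambda>/\<nu>\<^esup> / (|\<lambda>| - |\<nu>|)!\<close>.\<close>

definition skew_density :: "nat list \<Rightarrow> nat list \<Rightarrow> rat" where
  "skew_density \<nu> lam = plancherel_density lam * falling_value \<nu> lam"

lemma skew_density_base:
  assumes "strict_partition \<nu>" "strict_partition lam" "sum_list lam \<le> sum_list \<nu>"
  shows "skew_density \<nu> lam = of_bool (lam = \<nu>)"
proof (cases "lam = \<nu>")
  case True
  then show ?thesis
    using g_num_falling_value[OF assms(2)] by (simp add: skew_density_def plancherel_density_def)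
qed (use assms in \<open>simp add: skew_density_def falling_value_eq_0\<close>)

lemma skew_density_pieri:
  assumes "strict_partition \<nu>" "strict_partition lam"
  shows "(of_nat (sum_list lam) - of_nat (sum_list \<nu>)) * skew_density \<nu> lam = (\<Sum>\<nu>'\<in>up \<nu>. skew_density \<nu>' lam)"
  using falling_value_pieri[OF assms]
  by (simp add: skew_density_def sum_distrib_left[symmetric] mult.left_commute)

lemma sum_list_down: "strict_partition \<nu> \<Longrightarrow> \<kappa> \<in> down \<nu> \<Longrightarrow> sum_list \<nu> = Suc (sum_list \<kappa>)"
  by (simp add: down_def sum_list_up)

text \<open>Downward induction on \<open>\<nu>\<close>: the Pieri rule multiplies both sides by \<open>|\<mu>| + 1 - |\<nu>|\<close>, where the
  commutation relation accounts for the \<open>1\<close>.\<close>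

lemma sum_up_skew_density:
  assumes \<mu>: "strict_partition \<mu>" and \<nu>: "strict_partition \<nu>"
  shows "(\<Sum>lam\<in>up \<mu>. weight \<mu> lam * skew_density \<nu> lam) =
    skew_density \<nu> \<mu> + (\<Sum>\<kappa>\<in>down \<nu>. weight \<kappa> \<nu> * skew_density \<kappa> \<mu>)"
  using \<nu>
proof (induction "Suc (sum_list \<mu>) - sum_list \<nu>" arbitrary: \<nu>)
  case 0
  then have le: "Suc (sum_list \<mu>) \<le> sum_list \<nu>"
    by simp
  \<comment> \<open>Here |\<nu>| exceeds |\<mu>|, so the densities on covers of \<open>\<mu>\<close>
    and those of the \<open>\<kappa>\<close> at \<open>\<mu>\<close> are Kronecker deltas: both sums
    are \<open>weight \<mu> \<nu>\<close> if \<open>\<nu>\<close> covers \<open>\<mu>\<close>, and 0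
    otherwise.\<close>
  have "(\<Sum>lam\<in>up \<mu>. weight \<mu> lam * skew_density \<nu> lam) = (\<Sum>lam\<in>up \<mu>. if lam = \<nu> then weight \<mu> \<nu> else 0)"
    using 0 le sum_list_up[OF \<mu>] up_strict by (intro sum.cong refl) (simp add: skew_density_base)
  also have "\<dots> = (if \<nu> \<in> up \<mu> then weight \<mu> \<nu> else 0)"
    using finite_up[OF \<mu>] by simp
  also have "\<dots> = (if \<mu> \<in> down \<nu> then weight \<mu> \<nu> else 0)"
    using \<mu> by (simp add: down_def)
  also have "\<dots> = (\<Sum>\<kappa>\<in>down \<nu>. if \<mu> = \<kappa> then weight \<mu> \<nu> else 0)"
    using finite_down[OF 0(2)] by simp
  also have "\<dots> = (\<Sum>\<kappa>\<in>down \<nu>. weight \<kappa> \<nu> * skew_density \<kappa> \<mu>)"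
    using le sum_list_down[OF 0(2)] \<mu> down_strict by (intro sum.cong refl) (auto simp: skew_density_base)
  finally show ?case
    using skew_density_base[OF 0(2) \<mu>] le by auto
next
  case (Suc n)
  \<comment> \<open>The same number is |\<lambda>| - |\<nu>| for covers \<lambda> of
    \<open>\<mu>\<close> and |\<mu>| - |\<kappa>| for \<kappa> covered by \<open>\<nu>\<close>, so
    it is the Pieri factor on both sides.\<close>
  let ?r = "of_nat (Suc (sum_list \<mu>)) - of_nat (sum_list \<nu>) :: rat"
  have less: "sum_list \<nu> < Suc (sum_list \<mu>)"
    using Suc.hyps(2) by simp
  have up: "strict_partition \<nu>'" "n = Suc (sum_list \<mu>) - sum_list \<nu>'" if "\<nu>' \<in> up \<nu>" for \<nu>'
    using that Suc.hyps(2) sum_list_up[OF Suc.prems] up_strict by auto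
  have "?r * (\<Sum>lam\<in>up \<mu>. weight \<mu> lam * skew_density \<nu> lam) =
      (\<Sum>lam\<in>up \<mu>. weight \<mu> lam * ((of_nat (sum_list lam) - of_nat (sum_list \<nu>)) * skew_density \<nu> lam))"
    unfolding sum_distrib_left using sum_list_up[OF \<mu>] by (intro sum.cong refl) simp
  also have "\<dots> = (\<Sum>lam\<in>up \<mu>. \<Sum>\<nu>'\<in>up \<nu>. weight \<mu> lam * skew_density \<nu>' lam)"
    using up_strict by (intro sum.cong refl) (simp add: skew_density_pieri[OF Suc.prems] sum_distrib_left)
  also have "\<dots> = (\<Sum>\<nu>'\<in>up \<nu>. \<Sum>lam\<in>up \<mu>. weight \<mu> lam * skew_density \<nu>' lam)"
    by (rule sum.swap)
  also have "\<dots> = (\<Sum>\<nu>'\<in>up \<nu>. skew_density \<nu>' \<mu> + (\<Sum>\<kappa>\<in>down \<nu>'. weight \<kappa> \<nu>' * skew_density \<kappa> \<mu>))"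
    using up by (intro sum.cong refl Suc.hyps(1))
  also have "\<dots> = (of_nat (sum_list \<mu>) - of_nat (sum_list \<nu>)) * skew_density \<nu> \<mu> + skew_density \<nu> \<mu> +
      (\<Sum>\<kappa>\<in>down \<nu>. weight \<kappa> \<nu> * (\<Sum>\<nu>'\<in>up \<kappa>. skew_density \<nu>' \<mu>))"
    by (simp only: sum.distrib sum_up_down_commute[OF Suc.prems] skew_density_pieri[OF Suc.prems \<mu>] add.assoc)
  also have "(\<Sum>\<kappa>\<in>down \<nu>. weight \<kappa> \<nu> * (\<Sum>\<nu>'\<in>up \<kappa>. skew_density \<nu>' \<mu>)) =
      (\<Sum>\<kappa>\<in>down \<nu>. ?r * (weight \<kappa> \<nu> * skew_density \<kappa> \<mu>))"
  proof (intro sum.cong refl)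
    fix \<kappa>
    assume \<kappa>: "\<kappa> \<in> down \<nu>"
    then have "?r = of_nat (sum_list \<mu>) - of_nat (sum_list \<kappa>)"
      using sum_list_down[OF Suc.prems \<kappa>] by simp
    then show "weight \<kappa> \<nu> * (\<Sum>\<nu>'\<in>up \<kappa>. skew_density \<nu>' \<mu>) = ?r * (weight \<kappa> \<nu> * skew_density \<kappa> \<mu>)"
      unfolding skew_density_pieri[OF down_strict[OF \<kappa>] \<mu>, symmetric] by (simp only: mult.left_commute)
  qed
  also have "(of_nat (sum_list \<mu>) - of_nat (sum_list \<nu>)) * skew_density \<nu> \<mu> + skew_density \<nu> \<mu> +
      (\<Sum>\<kappa>\<in>down \<nu>. ?r * (weight \<kappa> \<nu> * skew_density \<kappa> \<mu>)) =
      ?r * (skew_density \<nu> \<mu> + (\<Sum>\<kappa>\<in>down \<nu>. weight \<kappa> \<nu> * skew_density \<kappa> \<mu>))"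
    by (simp add: algebra_simps sum_distrib_left)
  finally have "?r * (\<Sum>lam\<in>up \<mu>. weight \<mu> lam * skew_density \<nu> lam) = \<dots>" .
  moreover have "?r \<noteq> 0"
    using less by (simp del: of_nat_Suc)
  ultimately show ?case
    using mult_left_cancel by blast
qed

section \<open>Harmonic functions and their expectations\<close>

definition harmonic :: "(nat list \<Rightarrow> rat) \<Rightarrow> bool" where
  "harmonic h \<longleftrightarrow> (\<forall>\<mu>. strict_partition \<mu> \<longrightarrow>
     (\<Sum>lam\<in>up \<mu>. weight \<mu> lam * (plancherel_density lam * h lam)) = plancherel_density \<mu> * h \<mu>)"

lemma expect_harmonic:
  assumes h: "harmonic h" and \<mu>: "strict_partition \<mu>"
  shows "expect \<mu> n h = h \<mu>"
  using \<mu>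
proof (induction n arbitrary: \<mu>)
  case 0
  let ?f = "\<lambda>lam. fact (sum_list \<mu>) / fact (sum_list \<mu>) * 2 powi (int 0 - int (length lam) + int (length \<mu>))
      * (of_nat (g_num lam) / of_nat (g_num \<mu>)) * of_nat (g_skew lam \<mu>) * h lam"
  have "expect \<mu> 0 h = (\<Sum>lam\<in>SP (sum_list \<mu>). ?f lam)"
    by (simp add: expect_def)
  also have "\<dots> = (\<Sum>lam\<in>SP (sum_list \<mu>). if lam = \<mu> then h \<mu> else 0)"
    using g_num_nonzero[OF 0] by (intro sum.cong refl) (auto simp: SP_def g_skew_base)
  also have "\<dots> = h \<mu>"
    using 0 by (simp add: SP_def[of "sum_list \<mu>"] sum.delta[OF finite_SP[of "sum_list \<mu>", unfolded SP_def]])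
  finally show ?case .
next
  case (Suc n)
  let ?m = "sum_list \<mu>"
  let ?t = "\<lambda>n m \<mu> lam. fact m / fact (n + m) * 2 powi (int n - int (length lam) + int (length \<mu>))
      * (of_nat (g_num lam) / of_nat (g_num \<mu>)) * of_nat (g_skew lam \<mu>) * h lam"
  \<comment> \<open>The weight of the first step from \<open>\<mu>\<close> to \<mu>'. The ratio of
    densities supplies m! / (m+1)! and g^\<mu>' / g^\<mu>, which combine with the summand for \<mu>'
    and \<open>n\<close> to the summand for \<open>\<mu>\<close> and \<open>n + 1\<close>.\<close>
  let ?a = "\<lambda>\<mu>'. weight \<mu> \<mu>' * (plancherel_density \<mu>' / plancherel_density \<mu>)"
  have up: "strict_partition \<mu>'" "sum_list \<mu>' = Suc ?m" if "\<mu>' \<in> up \<mu>" for \<mu>'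
    using that sum_list_up[OF Suc.prems] up_strict by auto
  have summand: "?t (Suc n) ?m \<mu> lam = (\<Sum>\<mu>'\<in>up \<mu>. ?a \<mu>' * ?t n (Suc ?m) \<mu>' lam)"
    if lam: "lam \<in> SP (Suc n + ?m)" for lam
  proof -
    have "of_nat (g_skew lam \<mu>) = (\<Sum>\<mu>'\<in>up \<mu>. of_nat (g_skew lam \<mu>') :: rat)"
      using lam Suc.prems by (subst g_skew_step) (auto simp: SP_def)
    then have "?t (Suc n) ?m \<mu> lam = (\<Sum>\<mu>'\<in>up \<mu>. fact ?m / fact (Suc n + ?m) *
        2 powi (int (Suc n) - int (length lam) + int (length \<mu>))
        * (of_nat (g_num lam) / of_nat (g_num \<mu>)) * of_nat (g_skew lam \<mu>') * h lam)"
      by (simp only: sum_distrib_left sum_distrib_right)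
    also have "\<dots> = (\<Sum>\<mu>'\<in>up \<mu>. ?a \<mu>' * ?t n (Suc ?m) \<mu>' lam)"
    proof (intro sum.cong refl)
      fix \<mu>'
      assume \<mu>': "\<mu>' \<in> up \<mu>"
      have exponent: "int (Suc n) - int (length lam) + int (length \<mu>) =
          (1 - int (length \<mu>') + int (length \<mu>)) + (int n - int (length lam) + int (length \<mu>'))"
        by simp
      have pow: "(2::rat) powi (int (Suc n) - int (length lam) + int (length \<mu>)) =
          weight \<mu> \<mu>' * 2 powi (int n - int (length lam) + int (length \<mu>'))"
        unfolding exponent weight_def by (rule power_int_add) simp
      have "g_num \<mu>' \<noteq> 0"
        using g_num_nonzero up(1)[OF \<mu>'] by blast
      moreover have "fact (Suc n + ?m) = (fact (n + Suc ?m) :: rat)"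
        by simp
      ultimately show "fact ?m / fact (Suc n + ?m) * 2 powi (int (Suc n) - int (length lam) + int (length \<mu>))
          * (of_nat (g_num lam) / of_nat (g_num \<mu>)) * of_nat (g_skew lam \<mu>') * h lam = ?a \<mu>' * ?t n (Suc ?m) \<mu>' lam"
        unfolding pow plancherel_density_def up(2)[OF \<mu>'] by (simp only: times_divide_eq_right times_divide_eq_left divide_divide_eq_left divide_divide_eq_right) (simp add: mult_ac del: fact_Suc)
    qed
    finally show ?thesis .
  qed
  have "expect \<mu> (Suc n) h = (\<Sum>lam\<in>SP (Suc n + ?m). ?t (Suc n) ?m \<mu> lam)"
    by (simp only: expect_def Let_def)
  also have "\<dots> = (\<Sum>lam\<in>SP (Suc n + ?m). \<Sum>\<mu>'\<in>up \<mu>. ?a \<mu>' * ?t n (Suc ?m) \<mu>' lam)"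
    by (intro sum.cong refl summand)
  also have "\<dots> = (\<Sum>\<mu>'\<in>up \<mu>. \<Sum>lam\<in>SP (Suc n + ?m). ?a \<mu>' * ?t n (Suc ?m) \<mu>' lam)"
    by (rule sum.swap)
  also have "\<dots> = (\<Sum>\<mu>'\<in>up \<mu>. ?a \<mu>' * expect \<mu>' n h)"
    by (intro sum.cong refl) (simp only: expect_def Let_def up sum_distrib_left add_Suc_shift)
  also have "\<dots> = (\<Sum>\<mu>'\<in>up \<mu>. weight \<mu> \<mu>' * (plancherel_density \<mu>' * h \<mu>')) / plancherel_density \<mu>"
    using up(1) unfolding sum_divide_distrib by (intro sum.cong refl) (simp add: Suc.IH)
  also have "\<dots> = h \<mu>"
    using h Suc.prems g_num_nonzero[OF Suc.prems] by (simp add: harmonic_def plancherel_density_def)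
  finally show ?case .
qed

text \<open>The case of empty \<nu> in \<open>sum_up_skew_density\<close>: the function P* is 1, and
  as the empty partition covers nothing there is no correction term.\<close>

lemma harmonic_1: "harmonic (\<lambda>_. 1)"
  unfolding harmonic_def
proof (intro allI impI)
  fix \<mu>
  assume \<mu>: "strict_partition \<mu>"
  have "down [] = {}"
    using sum_list_down[of "[]"] by auto
  then show "(\<Sum>lam\<in>up \<mu>. weight \<mu> lam * (plancherel_density lam * 1)) = plancherel_density \<mu> * 1"
    using sum_up_skew_density[OF \<mu> strict_partition_Nil] by (simp add: skew_density_def falling_value_def)
qed

section \<open>Schur P-functions and the cancellation of the correction terms\<close>

lemma schur_P:
  assumes "strict_partition \<nu>"
  shows schur_P_in_\<Gamma>: "schur_P \<nu> \<in> \<Gamma>"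
    and schur_P_distinct: "distinct xs \<Longrightarrow> schur_P \<nu> xs = sym_sum (\<lambda>x k. x ^ k) \<nu> (set xs)"
proof -
  have "\<exists>p. \<forall>x :: rat. x ^ a = x * poly p x" if "a \<in> set \<nu>" for a
  proof -
    have "a \<noteq> 0"
      using that assms by (metis strict_partition_iff)
    then obtain k where "a = Suc k"
      by (cases a) auto
    then show ?thesis
      by (intro exI[of _ "monom 1 k"]) (simp add: poly_monom)
  qed
  then have "\<forall>a\<in>set \<nu>. \<exists>p. \<forall>x :: rat. x ^ a = x * poly p x"
    by blast
  from symmetrised[of \<nu> "\<lambda>x k. x ^ k", OF this]
  show "schur_P \<nu> \<in> \<Gamma>" "distinct xs \<Longrightarrow> schur_P \<nu> xs = sym_sum (\<lambda>x k. x ^ k) \<nu> (set xs)"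
    by (simp_all add: schur_P_def)
qed

lemma factorial_P_at_partition:
  assumes "strict_partition \<nu>" "strict_partition lam"
  shows "at_partition (factorial_P \<nu>) lam = falling_value \<nu> lam"
proof -
  have "\<forall>a\<in>set \<nu>. \<exists>p. \<forall>x. falling x a = x * poly p x"
    using assms(1) by (metis falling_poly gr0I strict_partition_iff)
  moreover have "distinct (map of_nat lam :: rat list)"
    using assms(2) by (simp add: distinct_map strict_partition_def inj_on_def)
  ultimately show ?thesis
    by (simp add: at_partition_def factorial_P_def symmetrised_distinct falling_value_def)
qed

lemma schur_P_pieri:
  assumes "strict_partition \<kappa>"
  shows "(\<lambda>xs. \<Sum>\<nu>\<in>up \<kappa>. schur_P \<nu> xs) = (\<lambda>xs. power_sum 1 xs * schur_P \<kappa> xs)"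
proof (rule \<Gamma>_eq_if_eq_on_distinct)
  show "(\<lambda>xs. \<Sum>\<nu>\<in>up \<kappa>. schur_P \<nu> xs) \<in> \<Gamma>"
    using assms by (intro \<Gamma>_sum schur_P_in_\<Gamma>) (auto simp: finite_up up_strict)
  show "(\<lambda>xs. power_sum 1 xs * schur_P \<kappa> xs) \<in> \<Gamma>"
    using assms by (intro \<Gamma>.mult \<Gamma>.power_sum schur_P_in_\<Gamma>) auto
next
  fix xs :: "rat list"
  assume "distinct xs"
  then show "(\<Sum>\<nu>\<in>up \<kappa>. schur_P \<nu> xs) = power_sum 1 xs * schur_P \<kappa> xs"
    using sym_sum_pieri_strict[of "\<lambda>x k. x ^ k" 0 "set xs" \<kappa>] assms
    by (simp add: schur_P_distinct up_strict power_sum_distinct)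
qed

lemma sum_up_X_char:
  assumes \<kappa>: "strict_partition \<kappa>" and \<rho>: "odd_partition \<rho>" "1 \<notin> set \<rho>"
  shows "(\<Sum>\<nu>\<in>up \<kappa>. weight \<kappa> \<nu> * X_char \<nu> \<rho>) = 0"
proof -
  let ?z = "z_factor \<rho> / 2 ^ length \<rho>"
  have "weight \<kappa> \<nu> * X_char \<nu> \<rho> = 2 ^ Suc (length \<kappa>) * ?z * (1 * p_coeff (schur_P \<nu>) \<rho>)"
    if "\<nu> \<in> up \<kappa>" for \<nu>
  proof -
    \<comment> \<open>Written as a sum over one index so that \<open>p_coeff_linear\<close> yields
      compatibility with scalar factors.\<close>
    have "schur_Q \<nu> = (\<lambda>xs. \<Sum>i\<in>{()}. 2 ^ length \<nu> * schur_P \<nu> xs)"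
      by (simp add: schur_Q_def fun_eq_iff)
    then have "p_coeff (schur_Q \<nu>) \<rho> = 2 ^ length \<nu> * p_coeff (schur_P \<nu>) \<rho>"
      using p_coeff_linear[of "{()}" "\<lambda>_. schur_P \<nu>" "\<lambda>_. 2 ^ length \<nu>" \<rho>] schur_P_in_\<Gamma>[OF up_strict[OF that]]
      by simp
    \<comment> \<open>The factor turning P into Q cancels the dependence of the weight on
      \<open>\<nu>\<close>, so a common constant can be pulled out of the sum over covers.\<close>
    moreover have "weight \<kappa> \<nu> * 2 ^ length \<nu> = 2 ^ Suc (length \<kappa>)"
    proof -
      have "weight \<kappa> \<nu> * 2 powi int (length \<nu>) = 2 powi int (Suc (length \<kappa>))"
        unfolding weight_def by (subst power_int_add[symmetric]) simp_all
      then show ?thesis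
        by (simp only: power_int_of_nat)
    qed
    ultimately show ?thesis
      using \<rho>(1) by (simp add: X_char_def scalar_product_power_sum_part mult_ac)
  qed
  then have "(\<Sum>\<nu>\<in>up \<kappa>. weight \<kappa> \<nu> * X_char \<nu> \<rho>) =
      2 ^ Suc (length \<kappa>) * ?z * (\<Sum>\<nu>\<in>up \<kappa>. 1 * p_coeff (schur_P \<nu>) \<rho>)"
    by (simp add: sum_distrib_left)
  also have "(\<Sum>\<nu>\<in>up \<kappa>. 1 * p_coeff (schur_P \<nu>) \<rho>) = p_coeff (\<lambda>xs. \<Sum>\<nu>\<in>up \<kappa>. 1 * schur_P \<nu> xs) \<rho>"
    using \<kappa> up_strict schur_P_in_\<Gamma> by (intro p_coeff_linear[symmetric]) (auto simp: finite_up)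
  also have "\<dots> = 0"
    using p_coeff_power_sum_1_mult[OF schur_P_in_\<Gamma>[OF \<kappa>] \<rho>(2)] by (simp add: schur_P_pieri[OF \<kappa>])
  finally show ?thesis by simp
qed

lemma harmonic_frak_p:
  assumes \<rho>: "odd_partition \<rho>" "1 \<notin> set \<rho>"
  shows "harmonic (at_partition (frak_p \<rho>))"
  unfolding harmonic_def
proof (intro allI impI)
  fix \<mu>
  assume \<mu>: "strict_partition \<mu>"
  let ?S = "SP (sum_list \<rho>)"
  have S: "strict_partition \<nu>" if "\<nu> \<in> ?S" for \<nu>
    using that by (simp add: SP_def)
  have frak: "plancherel_density lam * at_partition (frak_p \<rho>) lam = (\<Sum>\<nu>\<in>?S. X_char \<nu> \<rho> * skew_density \<nu> lam)"
    if "strict_partition lam" for lam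
  proof -
    have "at_partition (frak_p \<rho>) lam = (\<Sum>\<nu>\<in>?S. X_char \<nu> \<rho> * at_partition (factorial_P \<nu>) lam)"
      by (simp add: at_partition_def frak_p_def)
    also have "\<dots> = (\<Sum>\<nu>\<in>?S. X_char \<nu> \<rho> * falling_value \<nu> lam)"
      using S that by (intro sum.cong refl) (simp add: factorial_P_at_partition)
    finally show ?thesis
      by (simp add: skew_density_def sum_distrib_left mult.left_commute)
  qed
  \<comment> \<open>The correction terms are regrouped by \<open>\<kappa>\<close>, of size one less
    than \<open>\<rho>\<close>, and each inner sum vanishes by \<open>sum_up_X_char\<close>. If
    \<open>\<rho>\<close> has size 0 there is no such \<open>\<kappa>\<close>.\<close>
  have rest: "(\<Sum>\<nu>\<in>?S. \<Sum>\<kappa>\<in>down \<nu>. X_char \<nu> \<rho> * (weight \<kappa> \<nu> * skew_density \<kappa> \<mu>)) = 0"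
  proof (cases "sum_list \<rho>")
    case 0
    have "down \<nu> = {}" if "\<nu> \<in> ?S" for \<nu>
    proof (rule equals0I)
      fix \<kappa>
      assume "\<kappa> \<in> down \<nu>"
      then have "sum_list \<nu> = Suc (sum_list \<kappa>)"
        using sum_list_down S that by blast
      then show False
        using that 0 by (simp add: SP_def del: sum_list_eq_0_iff)
    qed
    then show ?thesis by simp
  next
    case (Suc k)
    have down: "down \<nu> = {\<kappa> \<in> SP k. \<nu> \<in> up \<kappa>}" if "\<nu> \<in> ?S" for \<nu>
      using that Suc sum_list_up[of _ \<nu>] by (auto simp: down_def SP_def)
    have up: "up \<kappa> = {\<nu> \<in> ?S. \<nu> \<in> up \<kappa>}" if "\<kappa> \<in> SP k" for \<kappa>
      using that Suc sum_list_up[of \<kappa>] up_strict by (auto simp: SP_def)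
    have "(\<Sum>\<nu>\<in>?S. \<Sum>\<kappa>\<in>down \<nu>. X_char \<nu> \<rho> * (weight \<kappa> \<nu> * skew_density \<kappa> \<mu>)) =
        (\<Sum>\<nu>\<in>?S. \<Sum>\<kappa> | \<kappa> \<in> SP k \<and> \<nu> \<in> up \<kappa>. X_char \<nu> \<rho> * (weight \<kappa> \<nu> * skew_density \<kappa> \<mu>))"
      by (intro sum.cong refl down)
    also have "\<dots> = (\<Sum>\<kappa>\<in>SP k. \<Sum>\<nu> | \<nu> \<in> ?S \<and> \<nu> \<in> up \<kappa>. X_char \<nu> \<rho> * (weight \<kappa> \<nu> * skew_density \<kappa> \<mu>))"
      by (rule sum.swap_restrict) simp_all
    also have "\<dots> = (\<Sum>\<kappa>\<in>SP k. (\<Sum>\<nu>\<in>up \<kappa>. weight \<kappa> \<nu> * X_char \<nu> \<rho>) * skew_density \<kappa> \<mu>)"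
      by (intro sum.cong refl) (simp add: up[symmetric] sum_distrib_left mult_ac)
    also have "\<dots> = 0"
      using \<rho> by (intro sum.neutral) (simp add: sum_up_X_char SP_def)
    finally show ?thesis .
  qed
  have "(\<Sum>lam\<in>up \<mu>. weight \<mu> lam * (plancherel_density lam * at_partition (frak_p \<rho>) lam)) =
      (\<Sum>lam\<in>up \<mu>. \<Sum>\<nu>\<in>?S. X_char \<nu> \<rho> * (weight \<mu> lam * skew_density \<nu> lam))"
    using up_strict by (intro sum.cong refl) (simp add: frak sum_distrib_left mult.left_commute)
  also have "\<dots> = (\<Sum>\<nu>\<in>?S. X_char \<nu> \<rho> * (\<Sum>lam\<in>up \<mu>. weight \<mu> lam * skew_density \<nu> lam))"
    unfolding sum_distrib_left by (rule sum.swap)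
  also have "\<dots> = (\<Sum>\<nu>\<in>?S. X_char \<nu> \<rho> * skew_density \<nu> \<mu>) +
      (\<Sum>\<nu>\<in>?S. \<Sum>\<kappa>\<in>down \<nu>. X_char \<nu> \<rho> * (weight \<kappa> \<nu> * skew_density \<kappa> \<mu>))"
    unfolding sum.distrib[symmetric] using S
    by (intro sum.cong refl) (simp add: sum_up_skew_density[OF \<mu>] distrib_left sum_distrib_left)
  finally show "(\<Sum>lam\<in>up \<mu>. weight \<mu> lam * (plancherel_density lam * at_partition (frak_p \<rho>) lam)) =
      plancherel_density \<mu> * at_partition (frak_p \<rho>) \<mu>"
    by (simp add: rest frak[OF \<mu>])
qed

theorem theorem4p2:
  fixes \<mu> :: "nat list" and m n :: nat
  assumes "\<mu> \<in> SP m"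
  shows "(\<forall>\<rho>. odd_partition \<rho> \<and> 1 \<notin> set \<rho> \<longrightarrow>
            expect \<mu> n (at_partition (frak_p \<rho>)) = at_partition (frak_p \<rho>) \<mu>) \<and>
         (\<Sum>lam\<in>SP (n + m).
            fact m / fact (n + m) * 2 powi (int n - int (length lam) + int (length \<mu>))
            * (of_nat (g_num lam) / of_nat (g_num \<mu>)) * of_nat (g_skew lam \<mu>)) = (1 :: rat)"
proof -
  have \<mu>: "strict_partition \<mu>" "sum_list \<mu> = m"
    using assms by (simp_all add: SP_def)
  show ?thesis
    \<comment> \<open>The normalisation is taken as the expectation of the constant 1, which avoids
      evaluating \<open>frak_p []\<close>.\<close>
    using expect_harmonic[OF harmonic_frak_p \<mu>(1)] expect_harmonic[OF harmonic_1 \<mu>(1), of n]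
    by (simp add: expect_def \<mu>(2))
qed

end
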